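(* Let $N\ge 1$ and let $V,W\colon\mathbb{R}^N\to\mathbb{R}$ be continuous functions with $\inf_{\mathbb{R}^N}V>0$ and $\inf_{\mathbb{R}^N}W>0$. Suppose that there exist $\alpha\in(0,1)$ and positive constants $c,C$ such that \[ 0<c\le W(x)\le C\big(V(x)\big)^{\alpha}\quad\text{for all }x\in\mathbb{R}^N . \] If $\lim_{|x|\to+\infty}V(x)=+\infty$, then $H^1_V(\mathbb{R}^N)$ is compactly embedded in $L^\tau_W(\mathbb{R}^N)$ for \[ \begin{cases}\tau\ge 2 & \text{if } N=1,2,\\[2pt] 2\le\tau<\dfrac{2N-4\alpha}{N-2} & \text{if } N\ge 3.\end{cases} \] Moreover, if $N\ge3$ and $\tau=\frac{2N-4\alpha}{N-2}$, the embedding of $H^1_V(\mathbb{R}^N)$ into $L^\tau_W(\mathbb{R}^N)$ is continuous (compactness is not asserted in this case).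
   Context: For a continuous $V\colon\mathbb{R}^N\to\mathbb{R}$ with positive infimum, $H^1_V(\mathbb{R}^N)$ is the completion of $C_0^\infty(\mathbb{R}^N)$ with respect to the norm $\|u\|_V=\left(\int_{\mathbb{R}^N}(|\nabla u|^2+V(x)|u|^2)\,dx\right)^{1/2}$. For a weight $W$ and $\tau\ge1$, $L^\tau_W(\mathbb{R}^N)=\{u \text{ measurable}: \int_{\mathbb{R}^N}W(x)|u|^\tau dx<+\infty\}$ with norm $\|u\|_{W,\tau}=\left(\int_{\mathbb{R}^N}W(x)|u|^\tau dx\right)^{1/\tau}$. *)

theory Defs
  imports "HOL-Analysis.Analysis"
begin

fun partials :: "'a::euclidean_space list \<Rightarrow> ('a \<Rightarrow> real) \<Rightarrow> ('a \<Rightarrow> real)" where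
  "partials [] f = f"
| "partials (i # is) f = (\<lambda>x. frechet_derivative (partials is f) (at x) i)"

definition smooth_fun :: "('a::euclidean_space \<Rightarrow> real) \<Rightarrow> bool" where
  "smooth_fun f \<longleftrightarrow> (\<forall>is. set is \<subseteq> Basis \<longrightarrow> (\<forall>x. partials is f differentiable (at x)))"

definition test_funs :: "('a::euclidean_space \<Rightarrow> real) set" where
  "test_funs = {f. smooth_fun f \<and> compact (closure {x. f x \<noteq> 0})}"

definition grad_sq :: "('a::euclidean_space \<Rightarrow> real) \<Rightarrow> 'a \<Rightarrow> real" where
  "grad_sq f x = (\<Sum>i\<in>Basis. (frechet_derivative f (at x) i)\<^sup>2)"

definition V_norm :: "('a::euclidean_space \<Rightarrow> real) \<Rightarrow> ('a \<Rightarrow> real) \<Rightarrow> real" where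
  "V_norm V f = sqrt (\<integral>x. grad_sq f x + V x * (f x)\<^sup>2 \<partial>lborel)"

(* phi is a ||.||_V-Cauchy sequence of test functions converging to u in L^2_V;
   this realises the completion H^1_V concretely as a space of functions *)
definition H1V_approx :: "('a::euclidean_space \<Rightarrow> real) \<Rightarrow> (nat \<Rightarrow> 'a \<Rightarrow> real) \<Rightarrow> ('a \<Rightarrow> real) \<Rightarrow> bool" where
  "H1V_approx V \<phi> u \<longleftrightarrow>
     (\<forall>n. \<phi> n \<in> test_funs) \<and>
     (\<forall>e>0. \<exists>M. \<forall>m\<ge>M. \<forall>n\<ge>M. V_norm V (\<lambda>x. \<phi> m x - \<phi> n x) < e) \<and>
     (\<forall>n. integrable lborel (\<lambda>x. V x * (\<phi> n x - u x)\<^sup>2)) \<and>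
     ((\<lambda>n. \<integral>x. V x * (\<phi> n x - u x)\<^sup>2 \<partial>lborel) \<longlonglongrightarrow> 0)"

definition H1V :: "('a::euclidean_space \<Rightarrow> real) \<Rightarrow> ('a \<Rightarrow> real) set" where
  "H1V V = {u. u \<in> borel_measurable lborel \<and> (\<exists>\<phi>. H1V_approx V \<phi> u)}"

(* norm on H^1_V: limit of the V-norms of an approximating sequence (independent of the choice) *)
definition H1V_norm :: "('a::euclidean_space \<Rightarrow> real) \<Rightarrow> ('a \<Rightarrow> real) \<Rightarrow> real" where
  "H1V_norm V u = lim (\<lambda>n. V_norm V ((SOME \<phi>. H1V_approx V \<phi> u) n))"

definition LW :: "('a::euclidean_space \<Rightarrow> real) \<Rightarrow> real \<Rightarrow> ('a \<Rightarrow> real) set" where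
  "LW W \<tau> = {u. u \<in> borel_measurable lborel \<and> integrable lborel (\<lambda>x. W x * \<bar>u x\<bar> powr \<tau>)}"

definition LW_norm :: "('a::euclidean_space \<Rightarrow> real) \<Rightarrow> real \<Rightarrow> ('a \<Rightarrow> real) \<Rightarrow> real" where
  "LW_norm W \<tau> u = (\<integral>x. W x * \<bar>u x\<bar> powr \<tau> \<partial>lborel) powr (1 / \<tau>)"

definition cont_embedded :: "('a::euclidean_space \<Rightarrow> real) \<Rightarrow> ('a \<Rightarrow> real) \<Rightarrow> real \<Rightarrow> bool" where
  "cont_embedded V W \<tau> \<longleftrightarrow> H1V V \<subseteq> LW W \<tau> \<and>
     (\<exists>K. \<forall>u\<in>H1V V. LW_norm W \<tau> u \<le> K * H1V_norm V u)"

definition compact_embedded :: "('a::euclidean_space \<Rightarrow> real) \<Rightarrow> ('a \<Rightarrow> real) \<Rightarrow> real \<Rightarrow> bool" where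
  "compact_embedded V W \<tau> \<longleftrightarrow> cont_embedded V W \<tau> \<and>
     (\<forall>u::nat \<Rightarrow> 'a \<Rightarrow> real. (\<forall>k. u k \<in> H1V V) \<and> (\<exists>B. \<forall>k. H1V_norm V (u k) \<le> B) \<longrightarrow>
        (\<exists>r v. strict_mono r \<and> v \<in> LW W \<tau> \<and>
           (\<lambda>k. LW_norm W \<tau> (\<lambda>x. u (r k) x - v x)) \<longlonglongrightarrow> 0))"

end

theory Submission
  imports Defs "HOL-Complex_Analysis.Great_Picard"
begin

text \<open>
  For a test function \<open>u\<close>, the bound \<open>W \<le> C V\<^sup>\<alpha>\<close> and Hoelder's inequality give
  \<open>\<integral> W \<bar>u\<bar>\<^sup>\<tau> \<le> C (\<integral> V u\<^sup>2)\<^sup>\<alpha> (\<integral> u\<^sup>2)\<^sup>b (\<integral> \<bar>u\<bar>\<^sup>p)\<^sup>d\<close> with \<open>\<alpha> + b + d = 1\<close> and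
  \<open>\<tau> = 2\<alpha> + 2b + p d\<close>, where \<open>p\<close> is an exponent for which the Sobolev inequality holds: the critical
  exponent \<open>2N/(N-2)\<close> if \<open>N \<ge> 3\<close>, and any even integer if \<open>N \<le> 2\<close>. The value \<open>b = 0\<close> corresponds
  to the critical \<open>\<tau>\<close>. Fatou's lemma extends the resulting bound from test functions to \<open>H\<^sup>1\<^sub>V\<close>.
  If \<open>b > 0\<close>, compactness reduces to compactness in \<open>L\<^sup>2\<close> of sequences of test functions with bounded
  energy: mass cannot escape to infinity because \<open>V\<close> tends to infinity, and on a ball a function with
  small means over a fine net of small balls has small \<open>L\<^sup>2\<close> norm.
\<close>

section \<open>Hoelder's inequality for extended nonnegative functions\<close>

text \<open>Functions in \<open>H1V V\<close> come without a derivative: the definition provides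
  only an approximating sequence. Hence every analytic estimate is proved for test functions and
  carried over by almost everywhere convergence; the limit in the compactness proof is likewise
  built pointwise, not by completeness of L^\<tau>_W. The Hoelder weight of V u^2 is forced to be
  \<alpha>, since that factor must produce exactly V^\<alpha>. The remaining weight 1 - \<alpha> is
  shared between u^2 and |u|^p. With b = 1 - \<alpha> - d the exponent is \<tau> = 2 + (p - 2) d, so
  \<tau> runs from 2 at d = 0 up to 2 \<alpha> + p (1 - \<alpha>) at b = 0; for p = 2N/(N - 2) this
  endpoint is (2N - 4 \<alpha>)/(N - 2). For b > 0 the factor (\<integral> u^2)^b tends to 0 on
  differences of an L^2-Cauchy sequence while the other two factors stay bounded by the energy. This
  turns compactness in L^2 into compactness in L^\<tau>_W; at b = 0 only boundedness is
  left.\<close>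

text \<open>The convention \<open>epow x 0 = 1\<close> differs from \<^const>\<open>powr\<close>, where \<open>0 powr 0 = 0\<close>.\<close>

definition epow :: "ennreal \<Rightarrow> real \<Rightarrow> ennreal" where
  "epow x a = (if a = 0 then 1 else if x = top then top else ennreal (enn2real x powr a))"

text \<open>Weight 0 really occurs: in the grid inequality at p = 1/(N - 1), and as b = 0 at the
  critical exponent. A factor of weight 0 has to disappear from the product, also where its base is
  0 or infinite.\<close>

lemma epow_0 [simp]: "epow x 0 = 1"
  by (simp add: epow_def)

lemma epow_ennreal: "0 \<le> x \<Longrightarrow> 0 < a \<Longrightarrow> epow (ennreal x) a = ennreal (x powr a)"
  by (simp add: epow_def)

lemma epow_eq_0_iff: "0 \<le> a \<Longrightarrow> epow x a = 0 \<longleftrightarrow> 0 < a \<and> x = 0"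
  by (cases x) (auto simp: epow_def)

lemma epow_eq_top_iff: "0 \<le> a \<Longrightarrow> epow x a = top \<longleftrightarrow> 0 < a \<and> x = top"
  by (cases x) (auto simp: epow_def)

lemma epow_mult: "0 \<le> a \<Longrightarrow> epow (x * y) a = epow x a * epow y a"
  by (cases x; cases y)
     (auto simp: epow_def powr_mult enn2real_mult ennreal_mult_top ennreal_top_mult
       simp flip: ennreal_mult)

lemma epow_add:
  assumes "0 \<le> a" "0 \<le> b" shows "epow x (a + b) = epow x a * epow x b"
  using assms by (cases x) (auto simp: epow_def powr_add simp flip: ennreal_mult)

lemma epow_ennreal_pos: "0 < x \<Longrightarrow> epow (ennreal x) a = ennreal (x powr a)"
  by (simp add: epow_def)

lemma epow_epow: "0 \<le> a \<Longrightarrow> 0 \<le> b \<Longrightarrow> epow (epow x a) b = epow x (a * b)"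
  by (cases x) (auto simp: epow_def powr_powr)

lemma epow_mono: "0 \<le> a \<Longrightarrow> x \<le> y \<Longrightarrow> epow x a \<le> epow y a"
  by (cases x; cases y) (auto simp: epow_def top_unique intro!: ennreal_leI powr_mono2)

lemma borel_measurable_epow [measurable]:
  assumes [measurable]: "f \<in> borel_measurable M"
  shows "(\<lambda>x. epow (f x) a) \<in> borel_measurable M"
  unfolding epow_def by measurable

text \<open>Jensen's inequality for \<open>exp\<close> at the points
  \<open>ln (x j)\<close>.\<close>

lemma weighted_arith_geom_mean:
  fixes x a :: "'i \<Rightarrow> real"
  assumes "finite J" "\<And>j. j \<in> J \<Longrightarrow> 0 \<le> a j" "sum a J = 1" "\<And>j. j \<in> J \<Longrightarrow> 0 < x j"
  shows "(\<Prod>j\<in>J. x j powr a j) \<le> (\<Sum>j\<in>J. a j * x j)"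
proof -
  have "J \<noteq> {}"
    using assms(3) by auto
  have "(\<Prod>j\<in>J. x j powr a j) = exp (\<Sum>j\<in>J. a j *\<^sub>R ln (x j))"
    unfolding exp_sum[OF assms(1)]
    by (intro prod.cong refl) (use assms(4) in \<open>simp add: powr_def less_imp_neq[symmetric]\<close>)
  also have "\<dots> \<le> (\<Sum>j\<in>J. a j * exp (ln (x j)))"
    using assms \<open>J \<noteq> {}\<close> by (intro convex_on_sum[OF _ _ exp_convex]) auto
  also have "\<dots> = (\<Sum>j\<in>J. a j * x j)"
    by (intro sum.cong refl) (use assms(4) in simp)
  finally show ?thesis .
qed

text \<open>The degenerate values are harmless: an infinite entry of positive weight makes the sum
  infinite, a zero entry of positive weight makes the product zero. What remains is the
  arithmetic-geometric mean inequality for positive reals.\<close>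

lemma prod_epow_le_sum:
  assumes J: "finite J" and a: "\<And>j. j \<in> J \<Longrightarrow> 0 \<le> a j" "sum a J = 1"
  shows "(\<Prod>j\<in>J. epow (x j) (a j)) \<le> (\<Sum>j\<in>J. ennreal (a j) * x j)"
proof -
  consider (top) j where "j \<in> J" "0 < a j" "x j = top" | (zero) j where "j \<in> J" "0 < a j" "x j = 0"
    | (pos) "\<And>j. j \<in> J \<Longrightarrow> 0 < a j \<Longrightarrow> 0 < x j \<and> x j < top"
    by (metis gr_zeroI top.not_eq_extremum)
  then show ?thesis
  proof cases
    case top
    then have "ennreal (a j) * x j = top" by (simp add: ennreal_mult_top)
    moreover have "ennreal (a j) * x j \<le> (\<Sum>j\<in>J. ennreal (a j) * x j)"
      using J top(1) by (intro member_le_sum) auto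
    ultimately show ?thesis by (simp add: top_unique)
  next
    case zero
    then have "(\<Prod>j\<in>J. epow (x j) (a j)) = 0"
      using J by (intro prod_zero bexI[of _ j]) (auto simp: epow_eq_0_iff)
    then show ?thesis by (simp only: zero_le)
  next
    case pos
    \<comment> \<open>Entries of weight 0 may still be 0 or infinite; the value 1 makes them
      positive reals without changing either side.\<close>
    define y where "y j = (if a j = 0 then 1 else enn2real (x j))" for j
    have y: "0 < y j" if "j \<in> J" for j
      using pos[OF that] a(1)[OF that] by (auto simp: y_def enn2real_positive_iff)
    have "(\<Prod>j\<in>J. epow (x j) (a j)) = (\<Prod>j\<in>J. ennreal (y j powr a j))"
      using pos a(1) by (intro prod.cong refl) (fastforce simp: epow_def y_def)
    also have "\<dots> = ennreal (\<Prod>j\<in>J. y j powr a j)"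
      by (simp add: prod_ennreal)
    also have "\<dots> \<le> ennreal (\<Sum>j\<in>J. a j * y j)"
      by (intro ennreal_leI weighted_arith_geom_mean J a y)
    also have "\<dots> = (\<Sum>j\<in>J. ennreal (a j) * ennreal (y j))"
      using a(1) y by (subst sum_ennreal[symmetric]) (auto simp: ennreal_mult less_imp_le)
    also have "\<dots> = (\<Sum>j\<in>J. ennreal (a j) * x j)"
    proof (intro sum.cong refl)
      fix j assume j: "j \<in> J"
      show "ennreal (a j) * ennreal (y j) = ennreal (a j) * x j"
        using pos[OF j] a(1)[OF j] by (cases "a j = 0") (auto simp: y_def)
    qed
    finally show ?thesis .
  qed
qed

text \<open>Divide every \<open>f j\<close> by its integral and apply the arithmetic-geometric mean
  inequality pointwise: the integral of the resulting weighted sum is the sum of the weights, which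
  is 1.\<close>

theorem nn_integral_Hoelder_prod:
  assumes J: "finite J" and a: "\<And>j. j \<in> J \<Longrightarrow> 0 \<le> a j" "sum a J = 1"
    and f [measurable]: "\<And>j. j \<in> J \<Longrightarrow> f j \<in> borel_measurable M"
  shows "(\<integral>\<^sup>+x. (\<Prod>j\<in>J. epow (f j x) (a j)) \<partial>M) \<le> (\<Prod>j\<in>J. epow (\<integral>\<^sup>+x. f j x \<partial>M) (a j))"
proof -
  define A where "A j = (\<integral>\<^sup>+x. f j x \<partial>M)" for j
  consider (zero) j where "j \<in> J" "0 < a j" "A j = 0"
    \<comment> \<open>Excluding vanishing integrals here keeps the infinite factor on the right from
      being multiplied by 0.\<close>
    | (top) j where "j \<in> J" "0 < a j" "A j = top" "\<And>j. j \<in> J \<Longrightarrow> 0 < a j \<Longrightarrow> A j \<noteq> 0"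
    | (pos) "\<And>j. j \<in> J \<Longrightarrow> 0 < a j \<Longrightarrow> A j \<noteq> 0 \<and> A j \<noteq> top"
    by metis
  then have "(\<integral>\<^sup>+x. (\<Prod>j\<in>J. epow (f j x) (a j)) \<partial>M) \<le> (\<Prod>j\<in>J. epow (A j) (a j))"
  proof cases
    case zero
    then have "AE x in M. f j x = 0"
      using f[OF zero(1)] by (simp add: A_def nn_integral_0_iff_AE)
    then have "AE x in M. (\<Prod>j\<in>J. epow (f j x) (a j)) = 0"
    proof eventually_elim
      case (elim x)
      then show ?case using J zero by (intro prod_zero bexI[of _ j]) (auto simp: epow_eq_0_iff)
    qed
    then have "(\<integral>\<^sup>+x. (\<Prod>j\<in>J. epow (f j x) (a j)) \<partial>M) = 0"
      by (subst nn_integral_0_iff_AE) measurable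
    then show ?thesis by simp
  next
    case top
    have "(\<Prod>j\<in>J. epow (A j) (a j)) = epow (A j) (a j) * (\<Prod>j\<in>J - {j}. epow (A j) (a j))"
      using J top(1) by (rule prod.remove)
    moreover have "(\<Prod>j\<in>J - {j}. epow (A j) (a j)) \<noteq> 0"
      using J a(1) top(4) by (auto simp: epow_eq_0_iff)
    moreover have "epow (A j) (a j) = top"
      using top by (simp add: epow_eq_top_iff)
    ultimately have "(\<Prod>j\<in>J. epow (A j) (a j)) = top"
      by (simp add: ennreal_top_mult)
    then show ?thesis by simp
  next
    case pos
    \<comment> \<open>The normalising constants; for weight 0 the integral may be 0 or infinite, so
      1 is used instead.\<close>
    define c where "c j = (if a j = 0 then 1 else A j)" for j
    have c: "c j \<noteq> 0" "c j \<noteq> top" if "j \<in> J" for j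
      using pos[OF that] a(1)[OF that] by (auto simp: c_def)
    have split: "(\<Prod>j\<in>J. epow (f j x) (a j)) = (\<Prod>j\<in>J. epow (c j) (a j)) * (\<Prod>j\<in>J. epow (f j x / c j) (a j))" for x
    proof -
      have "epow (f j x) (a j) = epow (c j) (a j) * epow (f j x / c j) (a j)" if "j \<in> J" for j
      proof -
        have "c j * (f j x / c j) = f j x"
          using c[OF that] by (metis ennreal_times_divide mult.commute mult_divide_eq_ennreal)
        then show ?thesis using a(1)[OF that] by (simp flip: epow_mult)
      qed
      then show ?thesis by (simp flip: prod.distrib)
    qed
    have "(\<integral>\<^sup>+x. (\<Prod>j\<in>J. epow (f j x) (a j)) \<partial>M)
        = (\<Prod>j\<in>J. epow (c j) (a j)) * (\<integral>\<^sup>+x. (\<Prod>j\<in>J. epow (f j x / c j) (a j)) \<partial>M)"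
      unfolding split by (rule nn_integral_cmult) measurable
    also have "\<dots> \<le> (\<Prod>j\<in>J. epow (c j) (a j)) * (\<integral>\<^sup>+x. (\<Sum>j\<in>J. ennreal (a j) * (f j x / c j)) \<partial>M)"
      by (intro mult_left_mono nn_integral_mono prod_epow_le_sum J a) auto
    also have "(\<integral>\<^sup>+x. (\<Sum>j\<in>J. ennreal (a j) * (f j x / c j)) \<partial>M) = (\<Sum>j\<in>J. \<integral>\<^sup>+x. ennreal (a j) * (f j x / c j) \<partial>M)"
      by (rule nn_integral_sum) measurable
    also have "\<dots> = (\<Sum>j\<in>J. ennreal (a j))"
    proof (intro sum.cong refl)
      fix j assume j: "j \<in> J"
      have [measurable]: "f j \<in> borel_measurable M" by (rule f[OF j])
      have "(\<integral>\<^sup>+x. ennreal (a j) * (f j x / c j) \<partial>M) = ennreal (a j) * (A j / c j)"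
        unfolding A_def by (subst nn_integral_cmult, measurable) (subst nn_integral_divide, auto)
      then show "(\<integral>\<^sup>+x. ennreal (a j) * (f j x / c j) \<partial>M) = ennreal (a j)"
        using pos[OF j] a(1)[OF j] by (cases "a j = 0") (auto simp: c_def top.not_eq_extremum)
    qed
    also have "\<dots> = 1"
      using a by simp
    also have "(\<Prod>j\<in>J. epow (c j) (a j)) = (\<Prod>j\<in>J. epow (A j) (a j))"
      by (intro prod.cong refl) (simp add: c_def)
    finally show ?thesis by simp
  qed
  then show ?thesis by (simp add: A_def)
qed

corollary nn_integral_Hoelder3:
  assumes "0 \<le> a" "0 \<le> b" "0 \<le> c" "a + b + c = 1"
    and [measurable]: "f \<in> borel_measurable M" "g \<in> borel_measurable M" "h \<in> borel_measurable M"
  shows "(\<integral>\<^sup>+x. epow (f x) a * (epow (g x) b * epow (h x) c) \<partial>M)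
    \<le> epow (\<integral>\<^sup>+x. f x \<partial>M) a * (epow (\<integral>\<^sup>+x. g x \<partial>M) b * epow (\<integral>\<^sup>+x. h x \<partial>M) c)"
proof -
  let ?f = "\<lambda>j::nat. if j = 0 then f else if j = 1 then g else h"
  let ?a = "\<lambda>j::nat. if j = 0 then a else if j = 1 then b else c"
  have "(\<integral>\<^sup>+x. (\<Prod>j\<in>{0,1,2}. epow (?f j x) (?a j)) \<partial>M) \<le> (\<Prod>j\<in>{0,1,2}. epow (\<integral>\<^sup>+x. ?f j x \<partial>M) (?a j))"
    by (rule nn_integral_Hoelder_prod) (use assms in auto)
  then show ?thesis by simp
qed


section \<open>The Gagliardo--Nirenberg grid inequality\<close>

lemma measurable_nn_integral_fun_upd [measurable]:
  fixes f :: "('i \<Rightarrow> real) \<Rightarrow> ennreal"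
  assumes [measurable]: "f \<in> borel_measurable (Pi\<^sub>M (insert i s) (\<lambda>_. lborel))"
  shows "(\<lambda>x. \<integral>\<^sup>+y. f (x(i := y)) \<partial>lborel) \<in> borel_measurable (Pi\<^sub>M s (\<lambda>_. lborel))"
proof -
  have "(\<lambda>(x, y). f (x(i := y))) \<in> borel_measurable (Pi\<^sub>M s (\<lambda>_. lborel) \<Otimes>\<^sub>M lborel)"
    using measurable_compose[OF measurable_add_dim[of i s "\<lambda>_. lborel"] assms]
    by (simp add: split_def)
  then show ?thesis
    by (rule lborel.borel_measurable_nn_integral)
qed

text \<open>Induction on the set of coordinates: Hoelder's inequality in one coordinate replaces
  \<open>f\<close> by its integral over that coordinate.\<close>

theorem nn_integral_grid_lines_le:
  fixes f :: "('i \<Rightarrow> real) \<Rightarrow> ennreal"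
  assumes "finite s" and p: "0 \<le> p" "(real (card s) - 1) * p \<le> 1"
    and "f \<in> borel_measurable (Pi\<^sub>M s (\<lambda>_. lborel))"
  shows "(\<integral>\<^sup>+x. epow (f x) (1 - (real (card s) - 1) * p) *
            (\<Prod>i\<in>s. epow (\<integral>\<^sup>+y. f (x(i := y)) \<partial>lborel) p) \<partial>Pi\<^sub>M s (\<lambda>_. lborel))
         \<le> epow (\<integral>\<^sup>+x. f x \<partial>Pi\<^sub>M s (\<lambda>_. lborel)) (1 + p)"
  using assms(1,3,4)
proof (induction s arbitrary: f)
  case empty
  interpret product_sigma_finite "\<lambda>_::'i. lborel :: real measure" ..
  show ?case by (simp add: nn_integral_empty)
next
  case (insert k s)
  interpret product_sigma_finite "\<lambda>_::'i. lborel :: real measure" ..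
  let ?P = "Pi\<^sub>M s (\<lambda>_. lborel :: real measure)"
  \<comment> \<open>\<open>a\<close> is the exponent of \<open>f\<close> for
    \<open>insert k s\<close>, which has one element more than \<open>s\<close>; that element
    cancels the -1 in the statement.\<close>
  define n where "n = real (card s)"
  define a where "a = 1 - n * p"
  define g where "g x = (\<integral>\<^sup>+y. f (x(k := y)) \<partial>lborel)" for x
  have a: "0 \<le> a" "1 - (real (card (insert k s)) - 1) * p = a"
    using insert by (auto simp: a_def n_def)
  have f [measurable]: "f \<in> borel_measurable (Pi\<^sub>M (insert k s) (\<lambda>_. lborel))"
    by (rule insert.prems)
  have g [measurable]: "g \<in> borel_measurable ?P"
    unfolding g_def by measurable
  have upd [measurable]: "(\<lambda>y. x(k := y)) \<in> lborel \<rightarrow>\<^sub>M Pi\<^sub>M (insert k s) (\<lambda>_. lborel)"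
    if "x \<in> space ?P" for x
    using measurable_component_update[OF that insert.hyps(2)] by simp
  have fG: "(\<lambda>(y, z). f (x(k := y, j := z))) \<in> borel_measurable (lborel \<Otimes>\<^sub>M lborel)"
    if x: "x \<in> space ?P" and j: "j \<in> s" for x j
  proof -
    have "(\<lambda>w. ((x(k := fst w))(j := snd w))) \<in> (lborel \<Otimes>\<^sub>M lborel) \<rightarrow>\<^sub>M Pi\<^sub>M (insert k s) (\<lambda>_. lborel)"
      by (rule measurable_fun_upd[where J = "insert k s"])
         (use j x insert.hyps in \<open>auto intro!: measurable_compose[OF measurable_fst upd]\<close>)
    from measurable_compose[OF this f] show ?thesis by (simp add: split_def)
  qed
  have inner: "(\<integral>\<^sup>+y. epow (f (x(k := y))) a *
      (\<Prod>i\<in>insert k s. epow (\<integral>\<^sup>+z. f ((x(k := y))(i := z)) \<partial>lborel) p) \<partial>lborel)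
      \<le> epow (g x) (1 - (n - 1) * p) * (\<Prod>i\<in>s. epow (\<integral>\<^sup>+z. g (x(i := z)) \<partial>lborel) p)"
    if x: "x \<in> space ?P" for x
  proof -
    \<comment> \<open>For fixed remaining coordinates, the line integral in direction
      \<open>k\<close> does not depend on \<open>y\<close> and leaves the integral as
      \<open>epow (g x) p\<close>. The other factors are the family \<open>h\<close>:
      \<open>f\<close> itself with weight \<open>a\<close>, stored at index \<open>k\<close>, and
      the line integrals in the directions of \<open>s\<close> with weight \<open>p\<close> each.
      The weights add up to a + n p = 1.\<close>
    define h where "h j = (if j = k then (\<lambda>y. f (x(k := y)))
        else (\<lambda>y. \<integral>\<^sup>+z. f (x(k := y, j := z)) \<partial>lborel))" for j
    have h [measurable]: "h j \<in> borel_measurable lborel" if "j \<in> insert k s" for j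
    proof (cases "j = k")
      case True
      then show ?thesis
        using measurable_compose[OF upd[OF x] f] by (simp add: h_def)
    next
      case False
      then have "j \<in> s" using that by simp
      from lborel.borel_measurable_nn_integral[OF fG[OF x this]] False show ?thesis
        by (simp add: h_def)
    qed
    let ?w = "\<lambda>j. if j = k then a else p"
    have "sum ?w s = (\<Sum>_\<in>s. p)"
      using insert.hyps by (intro sum.cong) auto
    then have w: "sum ?w (insert k s) = 1"
      using insert.hyps by (simp add: a_def n_def)
    have "(\<integral>\<^sup>+y. epow (f (x(k := y))) a *
        (\<Prod>i\<in>insert k s. epow (\<integral>\<^sup>+z. f ((x(k := y))(i := z)) \<partial>lborel) p) \<partial>lborel)
        = (\<integral>\<^sup>+y. epow (g x) p * (\<Prod>j\<in>insert k s. epow (h j y) (?w j)) \<partial>lborel)"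
    proof (rule nn_integral_cong)
      fix y
      have "(\<Prod>j\<in>s. epow (h j y) (?w j)) = (\<Prod>j\<in>s. epow (\<integral>\<^sup>+z. f (x(k := y, j := z)) \<partial>lborel) p)"
        using insert.hyps by (intro prod.cong refl) (auto simp: h_def)
      then show "epow (f (x(k := y))) a *
          (\<Prod>i\<in>insert k s. epow (\<integral>\<^sup>+z. f ((x(k := y))(i := z)) \<partial>lborel) p)
          = epow (g x) p * (\<Prod>j\<in>insert k s. epow (h j y) (?w j))"
        using insert.hyps by (simp add: h_def g_def ac_simps)
    qed
    also have "\<dots> = epow (g x) p * (\<integral>\<^sup>+y. (\<Prod>j\<in>insert k s. epow (h j y) (?w j)) \<partial>lborel)"
      by (rule nn_integral_cmult) measurable
    also have "\<dots> \<le> epow (g x) p * (\<Prod>j\<in>insert k s. epow (\<integral>\<^sup>+y. h j y \<partial>lborel) (?w j))"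
      using insert.hyps a(1) p(1) w h
      by (intro mult_left_mono nn_integral_Hoelder_prod) (auto split: if_splits)
    also have "(\<Prod>j\<in>insert k s. epow (\<integral>\<^sup>+y. h j y \<partial>lborel) (?w j))
        = epow (g x) a * (\<Prod>j\<in>s. epow (\<integral>\<^sup>+z. g (x(j := z)) \<partial>lborel) p)"
    proof -
      have "epow (\<integral>\<^sup>+y. h j y \<partial>lborel) (?w j) = epow (\<integral>\<^sup>+z. g (x(j := z)) \<partial>lborel) p"
        if j: "j \<in> s" for j
      proof -
        have "j \<noteq> k" using j insert.hyps by auto
        then have "(\<integral>\<^sup>+y. h j y \<partial>lborel) = (\<integral>\<^sup>+y. \<integral>\<^sup>+z. f (x(k := y, j := z)) \<partial>lborel \<partial>lborel)"
          by (simp add: h_def)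
        \<comment> \<open>Tonelli: integrating a line integral in direction \<open>j\<close> over
          coordinate \<open>k\<close> gives the line integral of \<open>g\<close> in direction
          \<open>j\<close>.\<close>
        also have "\<dots> = (\<integral>\<^sup>+z. \<integral>\<^sup>+y. f (x(k := y, j := z)) \<partial>lborel \<partial>lborel)"
          using lborel_pair.Fubini'[OF fG[OF x j]] by simp
        also have "\<dots> = (\<integral>\<^sup>+z. g (x(j := z)) \<partial>lborel)"
          using \<open>j \<noteq> k\<close> by (simp add: g_def fun_upd_twist)
        finally show ?thesis using \<open>j \<noteq> k\<close> by simp
      qed
      then show ?thesis
        using insert.hyps by (simp add: h_def g_def)
    qed
    also have "epow (g x) p * (epow (g x) a * (\<Prod>j\<in>s. epow (\<integral>\<^sup>+z. g (x(j := z)) \<partial>lborel) p))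
       = epow (g x) (p + a) * (\<Prod>j\<in>s. epow (\<integral>\<^sup>+z. g (x(j := z)) \<partial>lborel) p)"
      using a p by (simp add: epow_add ac_simps)
    \<comment> \<open>The factor from direction \<open>k\<close> raises the exponent of
      \<open>g\<close> to exactly the one that the induction hypothesis has for
      \<open>s\<close>.\<close>
    also have "p + a = 1 - (n - 1) * p"
      by (simp add: a_def algebra_simps)
    finally show ?thesis .
  qed
  have "(real (card s) - 1) * p \<le> 1"
    using insert.prems(1) insert.hyps p(1) by (simp add: algebra_simps)
  have [measurable]: "(\<lambda>x. \<integral>\<^sup>+ y. f (x(i := y)) \<partial>lborel) \<in> borel_measurable (Pi\<^sub>M (insert k s) (\<lambda>_. lborel))"
    if "i \<in> insert k s" for i
    by (rule measurable_nn_integral_fun_upd) (use that in \<open>simp add: insert_absorb\<close>)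
  have "(\<integral>\<^sup>+x. epow (f x) a * (\<Prod>i\<in>insert k s. epow (\<integral>\<^sup>+y. f (x(i := y)) \<partial>lborel) p)
           \<partial>Pi\<^sub>M (insert k s) (\<lambda>_. lborel))
      = (\<integral>\<^sup>+x. \<integral>\<^sup>+y. epow (f (x(k := y))) a *
          (\<Prod>i\<in>insert k s. epow (\<integral>\<^sup>+z. f ((x(k := y))(i := z)) \<partial>lborel) p) \<partial>lborel \<partial>?P)"
    by (rule product_nn_integral_insert[OF insert.hyps]) measurable
  also have "\<dots> \<le> (\<integral>\<^sup>+x. epow (g x) (1 - (n - 1) * p) *
                (\<Prod>i\<in>s. epow (\<integral>\<^sup>+z. g (x(i := z)) \<partial>lborel) p) \<partial>?P)"
    by (intro nn_integral_mono inner)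
  also have "\<dots> \<le> epow (\<integral>\<^sup>+x. g x \<partial>?P) (1 + p)"
    unfolding n_def by (rule insert.IH) fact+
  also have "(\<integral>\<^sup>+x. g x \<partial>?P) = (\<integral>\<^sup>+x. f x \<partial>Pi\<^sub>M (insert k s) (\<lambda>_. lborel))"
    unfolding g_def by (rule product_nn_integral_insert[OF insert.hyps f, symmetric])
  finally show ?case unfolding a(2) .
qed

text \<open>The choice p = 1/(N - 1) makes the exponent of \<open>F\<close> itself vanish, so that
  only the line integrals remain. The rest is transport from the product measure to
  \<open>lborel\<close>.\<close>

corollary nn_integral_prod_line_integrals_le:
  fixes F :: "'a::euclidean_space \<Rightarrow> ennreal"
  assumes F [measurable]: "F \<in> borel_measurable borel" and N: "2 \<le> DIM('a)"
  shows "(\<integral>\<^sup>+x. (\<Prod>i\<in>Basis. epow (\<integral>\<^sup>+t. F (x + t *\<^sub>R i) \<partial>lborel) (1 / (real DIM('a) - 1))) \<partial>lborel)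
         \<le> epow (\<integral>\<^sup>+x. F x \<partial>lborel) (real DIM('a) / (real DIM('a) - 1))"
proof -
  define p where "p = 1 / (real DIM('a) - 1)"
  define T :: "('a \<Rightarrow> real) \<Rightarrow> 'a" where "T w = (\<Sum>b\<in>Basis. w b *\<^sub>R b)" for w
  let ?P = "Pi\<^sub>M (Basis::'a set) (\<lambda>_. lborel :: real measure)"
  have T [measurable]: "T \<in> ?P \<rightarrow>\<^sub>M borel"
    unfolding T_def by measurable
  have p: "0 \<le> p" "(real DIM('a) - 1) * p = 1" "1 + p = real DIM('a) / (real DIM('a) - 1)"
    using N by (auto simp: p_def field_simps)
  \<comment> \<open>The line is parametrised by displacement from the base point, the grid
    inequality by the absolute coordinate \<open>y\<close>; they differ by the shift
    \<open>w i\<close>, which does not affect the integral.\<close>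
  have T_upd: "T (w(i := y)) = T w + (- w i + 1 * y) *\<^sub>R i" if "i \<in> Basis" for w i y
  proof -
    have "(\<Sum>b\<in>Basis - {i}. (w(i := y)) b *\<^sub>R b) = (\<Sum>b\<in>Basis - {i}. w b *\<^sub>R b)"
      by (intro sum.cong refl) auto
    with that show ?thesis
      unfolding T_def by (simp add: sum.remove[of _ i] algebra_simps)
  qed
  have line: "(\<integral>\<^sup>+t. F (T w + t *\<^sub>R i) \<partial>lborel) = (\<integral>\<^sup>+y. F (T (w(i := y))) \<partial>lborel)" if "i \<in> Basis" for w i
    unfolding T_upd[OF that]
    by (subst nn_integral_real_affine[where c = 1 and t = "- w i"]) auto
  have "(\<integral>\<^sup>+x. (\<Prod>i\<in>Basis. epow (\<integral>\<^sup>+t. F (x + t *\<^sub>R i) \<partial>lborel) p) \<partial>lborel)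
      = (\<integral>\<^sup>+w. (\<Prod>i\<in>Basis. epow (\<integral>\<^sup>+t. F (T w + t *\<^sub>R i) \<partial>lborel) p) \<partial>?P)"
    unfolding lborel_eq[where 'a='a] T_def[symmetric] by (rule nn_integral_distr) measurable
  also have "\<dots> = (\<integral>\<^sup>+w. epow (F (T w)) (1 - (real (card (Basis::'a set)) - 1) * p) *
      (\<Prod>i\<in>Basis. epow (\<integral>\<^sup>+y. F (T (w(i := y))) \<partial>lborel) p) \<partial>?P)"
    using line p(2) by simp
  also have "\<dots> \<le> epow (\<integral>\<^sup>+w. F (T w) \<partial>?P) (1 + p)"
    using p by (intro nn_integral_grid_lines_le) auto
  also have "(\<integral>\<^sup>+w. F (T w) \<partial>?P) = (\<integral>\<^sup>+x. F x \<partial>lborel)"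
    unfolding lborel_eq[where 'a='a] T_def[symmetric] by (rule nn_integral_distr[symmetric]) measurable
  finally show ?thesis unfolding p(3) unfolding p_def .
qed

section \<open>Test functions\<close>

lemma test_funs_partials_differentiable:
  "f \<in> test_funs \<Longrightarrow> set is \<subseteq> Basis \<Longrightarrow> partials is f differentiable (at x)"
  by (auto simp: test_funs_def smooth_fun_def)

lemma test_funs_has_derivative:
  "f \<in> test_funs \<Longrightarrow> (f has_derivative frechet_derivative f (at x)) (at x)"
  using test_funs_partials_differentiable[of f "[]" x] by (simp add: frechet_derivative_works)

lemma test_funs_continuous:
  assumes "f \<in> test_funs" shows "continuous_on S f"
  by (rule has_derivative_continuous_on)
     (rule has_derivative_at_withinI[OF test_funs_has_derivative[OF assms]])

lemma test_funs_partial_continuous: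
  assumes "f \<in> test_funs" "i \<in> Basis"
  shows "continuous_on S (\<lambda>x. frechet_derivative f (at x) i)"
proof -
  have "(\<lambda>x. frechet_derivative f (at x) i) differentiable (at x)" for x
    using test_funs_partials_differentiable[of f "[i]" x] assms by simp
  then show ?thesis
    by (meson continuous_at_imp_continuous_on differentiable_imp_continuous_within)
qed

lemma test_funs_frechet_derivative_expand:
  assumes "f \<in> test_funs"
  shows "frechet_derivative f (at x) v = (\<Sum>i\<in>Basis. (v \<bullet> i) * frechet_derivative f (at x) i)"
proof -
  interpret linear "frechet_derivative f (at x)"
    using test_funs_has_derivative[OF assms, of x] by (simp add: has_derivative_linear)
  have "frechet_derivative f (at x) v = frechet_derivative f (at x) (\<Sum>i\<in>Basis. (v \<bullet> i) *\<^sub>R i)"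
    by (simp add: euclidean_representation)
  then show ?thesis by (simp only: sum scale real_scaleR_def)
qed

lemma test_funs_derivative_continuous:
  assumes "f \<in> test_funs"
  shows "continuous_on S (\<lambda>x. frechet_derivative f (at x) v)"
  unfolding test_funs_frechet_derivative_expand[OF assms, of _ v]
  by (intro continuous_intros test_funs_partial_continuous assms)

lemma grad_sq_continuous: "f \<in> test_funs \<Longrightarrow> continuous_on S (grad_sq f)"
  unfolding grad_sq_def by (intro continuous_intros test_funs_partial_continuous)

lemma grad_sq_nonneg [simp]: "0 \<le> grad_sq f x"
  by (simp add: grad_sq_def sum_nonneg)

lemma frechet_derivative_sq_le:
  assumes "f \<in> test_funs"
  shows "(frechet_derivative f (at x) v)\<^sup>2 \<le> (norm v)\<^sup>2 * grad_sq f x"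
proof -
  have "(norm v)\<^sup>2 = (\<Sum>i\<in>Basis. (v \<bullet> i)\<^sup>2)"
    by (simp add: norm_eq_sqrt_inner euclidean_inner[of v v] power2_eq_square sum_nonneg)
  then show ?thesis
    unfolding test_funs_frechet_derivative_expand[OF assms, of x v] grad_sq_def
    by (simp add: Cauchy_Schwarz_ineq_sum)
qed

lemma abs_partial_le_sqrt_grad_sq:
  assumes "f \<in> test_funs" "i \<in> Basis"
  shows "\<bar>frechet_derivative f (at x) i\<bar> \<le> sqrt (grad_sq f x)"
  using frechet_derivative_sq_le[OF assms(1), of x i] assms(2)
  by (intro real_le_rsqrt) simp

lemma test_funs_support:
  fixes f :: "'a::euclidean_space \<Rightarrow> real"
  assumes f: "f \<in> test_funs"
  obtains R where "0 < R" "\<And>x. R < norm x \<Longrightarrow> f x = 0" "\<And>x v. R < norm x \<Longrightarrow> frechet_derivative f (at x) v = 0"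
proof -
  have "bounded (closure {x. f x \<noteq> 0})"
    using f by (auto simp: test_funs_def compact_imp_bounded)
  then obtain R where R: "0 < R" "\<And>x. x \<in> closure {x. f x \<noteq> 0} \<Longrightarrow> norm x \<le> R"
    by (auto simp: bounded_pos)
  have 0: "f x = 0" if "R < norm x" for x
    using R(2)[of x] that closure_subset[of "{x. f x \<noteq> 0}"] by force
  have "frechet_derivative f (at x) = (\<lambda>v. 0)" if x: "R < norm x" for x
  proof -
    have "open (- cball (0::'a) R)" by (simp add: open_Compl)
    then have "frechet_derivative f (at x) = frechet_derivative (\<lambda>x. 0) (at x)"
      using x f 0 test_funs_has_derivative[OF f, of x]
      by (intro frechet_derivative_transform_within_open[of f x "- cball 0 R"])
         (auto simp: differentiable_def)
    then show ?thesis by simp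
  qed
  with 0 R(1) show ?thesis by (metis that)
qed

lemma integrable_continuous_bounded_support:
  fixes h :: "'a::euclidean_space \<Rightarrow> real"
  assumes "continuous_on UNIV h" "\<And>x. R < norm x \<Longrightarrow> h x = 0"
  shows "integrable lborel h"
proof -
  have "integrable lborel (\<lambda>x. indicator (cball 0 R) x *\<^sub>R h x)"
    by (intro borel_integrable_compact) (auto intro: continuous_on_subset[OF assms(1)])
  also have "(\<lambda>x. indicator (cball 0 R) x *\<^sub>R h x) = h"
    using assms(2) by (auto simp: indicator_def fun_eq_iff)
  finally show ?thesis .
qed

text \<open>Hypothesis \<open>0\<close> forces \<open>h\<close> to vanish outside the bounded set
  where \<open>f\<close> and its gradient live. Stated pointwise, it can be checked by
  simplification for every density used later.\<close>

lemma test_funs_integrable: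
  fixes f h :: "'a::euclidean_space \<Rightarrow> real"
  assumes f: "f \<in> test_funs" and h: "continuous_on UNIV h"
    and 0: "\<And>x. f x = 0 \<Longrightarrow> grad_sq f x = 0 \<Longrightarrow> h x = 0"
  shows "integrable lborel h"
proof -
  obtain R where "\<And>x. R < norm x \<Longrightarrow> f x = 0" "\<And>x v. R < norm x \<Longrightarrow> frechet_derivative f (at x) v = 0"
    using test_funs_support[OF f] by metis
  then show ?thesis
    by (intro integrable_continuous_bounded_support[OF h, of R] 0) (auto simp: grad_sq_def)
qed

lemma partials_diff:
  assumes "f \<in> test_funs" "g \<in> test_funs" "set is \<subseteq> Basis"
  shows "partials is (\<lambda>x. f x - g x) = (\<lambda>x. partials is f x - partials is g x)"
  using assms(3)
proof (induction "is")
  case (Cons i "is")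
  have "frechet_derivative (\<lambda>x. partials is f x - partials is g x) (at x) =
      (\<lambda>v. frechet_derivative (partials is f) (at x) v - frechet_derivative (partials is g) (at x) v)" for x
    using Cons.prems assms
    by (intro frechet_derivative_at[symmetric] has_derivative_diff)
       (auto simp flip: frechet_derivative_works intro: test_funs_partials_differentiable)
  with Cons show ?case by simp
qed simp

lemma test_funs_diff:
  assumes f: "f \<in> test_funs" and g: "g \<in> test_funs"
  shows "(\<lambda>x. f x - g x) \<in> test_funs"
proof -
  have "smooth_fun (\<lambda>x. f x - g x)"
    unfolding smooth_fun_def
    using partials_diff[OF f g] test_funs_partials_differentiable[OF f] test_funs_partials_differentiable[OF g]
    by (auto intro: differentiable_diff)
  moreover have "compact (closure {x. f x - g x \<noteq> 0})"
  proof -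
    have "{x. f x - g x \<noteq> 0} \<subseteq> {x. f x \<noteq> 0} \<union> {x. g x \<noteq> 0}"
      by auto
    moreover have "bounded ({x. f x \<noteq> 0} \<union> {x. g x \<noteq> 0})"
      using f g by (auto simp: test_funs_def)
    ultimately have "bounded {x. f x - g x \<noteq> 0}"
      by (rule bounded_subset[rotated])
    then show ?thesis by simp
  qed
  ultimately show ?thesis by (simp add: test_funs_def)
qed

lemma frechet_derivative_diff_test_funs:
  assumes "f \<in> test_funs" "g \<in> test_funs" "i \<in> Basis"
  shows "frechet_derivative (\<lambda>x. f x - g x) (at x) i
       = frechet_derivative f (at x) i - frechet_derivative g (at x) i"
  using partials_diff[OF assms(1,2), of "[i]"] assms(3) by (simp add: fun_eq_iff)

section \<open>Calculus along straight lines\<close>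

lemma test_funs_line_derivative:
  assumes "f \<in> test_funs"
  shows "((\<lambda>t. f (x + t *\<^sub>R v)) has_real_derivative frechet_derivative f (at (x + t *\<^sub>R v)) v) (at t)"
proof -
  interpret linear "frechet_derivative f (at (x + t *\<^sub>R v))"
    by (rule has_derivative_linear[OF test_funs_has_derivative[OF assms]])
  have "((\<lambda>t. x + t *\<^sub>R v) has_derivative (\<lambda>h. h *\<^sub>R v)) (at t)"
    by (auto intro!: derivative_eq_intros)
  from diff_chain_at[OF this, unfolded o_def, OF test_funs_has_derivative[OF assms]]
  show ?thesis
    by (simp add: has_field_derivative_def scale mult_commute_abs)
qed

lemma test_funs_line_derivative_continuous:
  assumes "f \<in> test_funs"
  shows "continuous_on S (\<lambda>t. frechet_derivative f (at (x + t *\<^sub>R v)) v)"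
  by (rule continuous_on_compose2[OF test_funs_derivative_continuous[OF assms, of UNIV v]])
     (auto intro!: continuous_intros)

lemma nn_integral_FTC_bound:
  fixes g :: "real \<Rightarrow> real"
  assumes ab: "a \<le> b" and g: "\<And>t. (g has_real_derivative g' t) (at t)" and g': "continuous_on UNIV g'"
  shows "ennreal \<bar>g b - g a\<bar> \<le> (\<integral>\<^sup>+t. ennreal \<bar>g' t\<bar> * indicator {a..b} t \<partial>lborel)"
proof -
  have cont: "continuous_on {a..b} g'"
    using g' by (rule continuous_on_subset) auto
  have "(\<integral>t. indicator {a..b} t *\<^sub>R g' t \<partial>lborel) = g b - g a"
    using g by (intro integral_FTC_atLeastAtMost ab cont)
       (auto intro: has_vector_derivative_at_within simp: has_real_derivative_iff_has_vector_derivative)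
  moreover have "integrable lborel (\<lambda>t. indicator {a..b} t *\<^sub>R g' t)"
    by (intro borel_integrable_compact cont) auto
  ultimately have "ennreal \<bar>g b - g a\<bar> \<le> (\<integral>\<^sup>+t. ennreal (norm (indicator {a..b} t *\<^sub>R g' t)) \<partial>lborel)"
    using integral_norm_bound_ennreal[of lborel "\<lambda>t. indicator {a..b} t *\<^sub>R g' t"] by simp
  also have "\<dots> = (\<integral>\<^sup>+t. ennreal \<bar>g' t\<bar> * indicator {a..b} t \<partial>lborel)"
    by (intro nn_integral_cong) (auto simp: indicator_def)
  finally show ?thesis .
qed

text \<open>The derivative is \<gamma> sgn(s) |s|^(\<gamma> - 1); the difference of two powers of
  nonnegative functions makes its continuity at 0 evident. At 0 the difference quotient has absolute
  value |h|^(\<gamma> - 1), which tends to 0 because \<gamma> > 1.\<close>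

lemma has_real_derivative_abs_powr:
  fixes s \<gamma> :: real
  assumes "1 < \<gamma>"
  shows "((\<lambda>s. \<bar>s\<bar> powr \<gamma>) has_real_derivative \<gamma> * (max s 0 powr (\<gamma> - 1) - max (- s) 0 powr (\<gamma> - 1))) (at s)"
proof -
  consider "0 < s" | "s < 0" | "s = 0" by linarith
  then show ?thesis
  proof cases
    case 1
    have "((\<lambda>s. s powr \<gamma>) has_real_derivative \<gamma> * s powr (\<gamma> - 1)) (at s)"
      using 1 by (auto intro!: derivative_eq_intros)
    then have "((\<lambda>s. \<bar>s\<bar> powr \<gamma>) has_real_derivative \<gamma> * s powr (\<gamma> - 1)) (at s)"
      by (rule has_field_derivative_transform_within_open[where S = "{0<..}"]) (use 1 in auto)
    then show ?thesis using 1 by simp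
  next
    case 2
    have "((\<lambda>s. (- s) powr \<gamma>) has_real_derivative - (\<gamma> * (- s) powr (\<gamma> - 1))) (at s)"
      using 2 by (auto intro!: derivative_eq_intros)
    then have "((\<lambda>s. \<bar>s\<bar> powr \<gamma>) has_real_derivative - (\<gamma> * (- s) powr (\<gamma> - 1))) (at s)"
      by (rule has_field_derivative_transform_within_open[where S = "{..<0}"]) (use 2 in auto)
    then show ?thesis using 2 by simp
  next
    case 3
    have "((\<lambda>h::real. \<bar>h\<bar> powr (\<gamma> - 1)) \<longlongrightarrow> \<bar>0\<bar> powr (\<gamma> - 1)) (at 0)"
      using assms by (intro tendsto_powr' tendsto_intros) auto
    then have "((\<lambda>h::real. norm (\<bar>h\<bar> powr \<gamma> / h)) \<longlongrightarrow> 0) (at 0)"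
      using assms
      by (auto elim!: Lim_transform_eventually simp: eventually_at_filter powr_diff)
    from tendsto_norm_zero_cancel[OF this]
    have "((\<lambda>h::real. \<bar>h\<bar> powr \<gamma> / h) \<longlongrightarrow> 0) (at 0)" .
    then show ?thesis
      using 3 by (simp add: DERIV_def)
  qed
qed

text \<open>Fundamental theorem of calculus for |f|^\<gamma>, started at a point of the line outside
  the support of \<open>f\<close>, with the partial derivative bounded by the length of the
  gradient.\<close>

lemma abs_powr_le_line_integral:
  fixes f :: "'a::euclidean_space \<Rightarrow> real"
  assumes f: "f \<in> test_funs" and i: "i \<in> Basis" and \<gamma>: "1 < \<gamma>"
  shows "ennreal (\<bar>f x\<bar> powr \<gamma>) \<le>
    (\<integral>\<^sup>+t. ennreal (\<gamma> * \<bar>f (x + t *\<^sub>R i)\<bar> powr (\<gamma> - 1) * sqrt (grad_sq f (x + t *\<^sub>R i))) \<partial>lborel)"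
proof -
  obtain R where R: "0 < R" "\<And>x. R < norm x \<Longrightarrow> f x = 0"
    using test_funs_support[OF f] by metis
  \<comment> \<open>Moving back by \<open>T\<close> leads outside the support: the norm of
    \<open>x - T *\<^sub>R i\<close> is at least T - |x| = R + 1.\<close>
  define T where "T = R + norm x + 1"
  have T: "- T \<le> 0"
    unfolding T_def using R(1) norm_ge_zero[of x] by linarith
  have "norm (x + (- T) *\<^sub>R i) = norm (T *\<^sub>R i - x)"
    by (simp add: norm_minus_commute)
  moreover have "norm (T *\<^sub>R i) = R + norm x + 1"
    using i R(1) by (simp add: T_def)
  ultimately have "R < norm (x + (- T) *\<^sub>R i)"
    using norm_triangle_ineq2[of "T *\<^sub>R i" x] by linarith
  then have fT: "f (x + (- T) *\<^sub>R i) = 0" by (rule R(2))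
  define d where "d s = max s 0 powr (\<gamma> - 1) - max (- s) 0 powr (\<gamma> - 1)" for s :: real
  define g' where "g' t = \<gamma> * d (f (x + t *\<^sub>R i)) * frechet_derivative f (at (x + t *\<^sub>R i)) i" for t
  have abs_d: "\<bar>d s\<bar> = \<bar>s\<bar> powr (\<gamma> - 1)" for s
    by (cases "0 \<le> s") (auto simp: d_def)
  have fc: "continuous_on UNIV (\<lambda>t. f (x + t *\<^sub>R i))"
    by (rule continuous_on_compose2[OF test_funs_continuous[OF f, of UNIV]]) (auto intro!: continuous_intros)
  have "continuous_on UNIV g'"
    unfolding g'_def d_def using \<gamma>
    by (intro continuous_intros continuous_on_powr' test_funs_line_derivative_continuous[OF f] fc) auto
  moreover have "((\<lambda>t. \<bar>f (x + t *\<^sub>R i)\<bar> powr \<gamma>) has_real_derivative g' t) (at t)" for t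
    unfolding g'_def d_def
    by (rule DERIV_chain2[OF has_real_derivative_abs_powr[OF \<gamma>] test_funs_line_derivative[OF f]])
  ultimately have "ennreal \<bar>\<bar>f (x + 0 *\<^sub>R i)\<bar> powr \<gamma> - \<bar>f (x + (- T) *\<^sub>R i)\<bar> powr \<gamma>\<bar>
      \<le> (\<integral>\<^sup>+t. ennreal \<bar>g' t\<bar> * indicator {- T..0} t \<partial>lborel)"
    by (intro nn_integral_FTC_bound T) auto
  also have "\<dots> \<le> (\<integral>\<^sup>+t. ennreal (\<gamma> * \<bar>f (x + t *\<^sub>R i)\<bar> powr (\<gamma> - 1) * sqrt (grad_sq f (x + t *\<^sub>R i))) \<partial>lborel)"
  proof (intro nn_integral_mono)
    fix t
    have "\<bar>g' t\<bar> \<le> \<gamma> * \<bar>f (x + t *\<^sub>R i)\<bar> powr (\<gamma> - 1) * sqrt (grad_sq f (x + t *\<^sub>R i))"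
      unfolding g'_def abs_mult abs_d
      using \<gamma> abs_partial_le_sqrt_grad_sq[OF f i] by (intro mult_mono) auto
    then show "ennreal \<bar>g' t\<bar> * indicator {- T..0} t
      \<le> ennreal (\<gamma> * \<bar>f (x + t *\<^sub>R i)\<bar> powr (\<gamma> - 1) * sqrt (grad_sq f (x + t *\<^sub>R i)))"
      by (auto simp: indicator_def intro!: ennreal_leI)
  qed
  finally show ?thesis
    using fT \<gamma> by simp
qed

section \<open>Sobolev inequalities for test functions\<close>

lemma test_funs_measurable [measurable_dest]:
  "f \<in> test_funs \<Longrightarrow> f \<in> borel_measurable borel"
  using test_funs_continuous[of f UNIV] by (rule borel_measurable_continuous_onI)

lemma test_funs_grad_sq_measurable [measurable_dest]:
  "f \<in> test_funs \<Longrightarrow> grad_sq f \<in> borel_measurable borel"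
  using grad_sq_continuous[of f UNIV] by (rule borel_measurable_continuous_onI)

lemma test_funs_integrable_abs_powr:
  fixes f :: "'a::euclidean_space \<Rightarrow> real"
  assumes "f \<in> test_funs" "0 < q" shows "integrable lborel (\<lambda>x. \<bar>f x\<bar> powr q)"
  using assms
  by (intro test_funs_integrable[of f] continuous_on_powr' continuous_intros test_funs_continuous) auto

lemma test_funs_integrable_grad_sq:
  fixes f :: "'a::euclidean_space \<Rightarrow> real"
  assumes "f \<in> test_funs" shows "integrable lborel (grad_sq f)"
  using assms by (intro test_funs_integrable[of f] grad_sq_continuous)

lemma test_funs_integrable_sq:
  fixes f V :: "'a::euclidean_space \<Rightarrow> real"
  assumes "f \<in> test_funs" "continuous_on UNIV V" shows "integrable lborel (\<lambda>x. V x * (f x)\<^sup>2)"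
  using assms by (intro test_funs_integrable[of f] continuous_intros test_funs_continuous[of f]) auto

text \<open>Each of the N coordinate directions bounds |f|^\<gamma> by a line integral of F =
  \<gamma> |f|^(\<gamma> - 1) |grad f|. Multiplying the N bounds, each to the power 1/(N - 1), gives
  |f|^(\<gamma> N/(N - 1)) on the left and the grid inequality on the right; Cauchy-Schwarz
  separates the two factors of F. The parameter \<gamma> stays free because N = 2 and N \<ge> 3 use
  it differently.\<close>

lemma Gagliardo_Nirenberg:
  fixes f :: "'a::euclidean_space \<Rightarrow> real"
  assumes f: "f \<in> test_funs" and N: "2 \<le> DIM('a)" and \<gamma>: "1 < \<gamma>"
  defines "N \<equiv> real DIM('a)"
  shows "(\<integral>x. \<bar>f x\<bar> powr (\<gamma> * (N / (N - 1))) \<partial>lborel)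
     \<le> (\<gamma>\<^sup>2 * (\<integral>x. \<bar>f x\<bar> powr (2 * \<gamma> - 2) \<partial>lborel) * (\<integral>x. grad_sq f x \<partial>lborel)) powr (N / (2 * (N - 1)))"
proof -
  have N2: "2 \<le> N" using N by (simp add: N_def)
  define p where "p = 1 / (N - 1)"
  define S where "S = (\<integral>x. \<bar>f x\<bar> powr (2 * \<gamma> - 2) \<partial>lborel)"
  define D where "D = (\<integral>x. grad_sq f x \<partial>lborel)"
  define F where "F x = \<gamma> * \<bar>f x\<bar> powr (\<gamma> - 1) * sqrt (grad_sq f x)" for x
  \<comment> \<open>The Cauchy-Schwarz bound for the integral of \<open>F\<close>.\<close>
  define r where "r = sqrt (\<gamma>\<^sup>2 * S * D)"
  have p: "0 < p" using N2 by (simp add: p_def)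
  have [measurable]: "f \<in> borel_measurable borel" "grad_sq f \<in> borel_measurable borel"
    using f by measurable
  have [measurable]: "F \<in> borel_measurable borel"
    unfolding F_def by measurable
  have SD: "0 \<le> S" "0 \<le> D" by (simp_all add: S_def D_def)
  have "(\<integral>\<^sup>+x. ennreal (F x) \<partial>lborel)\<^sup>2
      = (\<integral>\<^sup>+x. ennreal (\<gamma> * \<bar>f x\<bar> powr (\<gamma> - 1)) * ennreal (sqrt (grad_sq f x)) \<partial>lborel)\<^sup>2"
    using \<gamma> by (simp add: F_def ennreal_mult)
  also have "\<dots> \<le> (\<integral>\<^sup>+x. ennreal (\<gamma> * \<bar>f x\<bar> powr (\<gamma> - 1)) ^ 2 \<partial>lborel) * (\<integral>\<^sup>+x. ennreal (sqrt (grad_sq f x)) ^ 2 \<partial>lborel)"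
    by (rule Cauchy_Schwarz_nn_integral) measurable
  also have "(\<integral>\<^sup>+x. ennreal (sqrt (grad_sq f x)) ^ 2 \<partial>lborel) = ennreal D"
    unfolding D_def using test_funs_integrable_grad_sq[OF f]
    by (simp add: ennreal_power nn_integral_eq_integral)
  also have "(\<integral>\<^sup>+x. ennreal (\<gamma> * \<bar>f x\<bar> powr (\<gamma> - 1)) ^ 2 \<partial>lborel) = (\<integral>\<^sup>+x. ennreal (\<gamma>\<^sup>2 * \<bar>f x\<bar> powr (2 * \<gamma> - 2)) \<partial>lborel)"
  proof (intro nn_integral_cong)
    fix x
    have "(\<bar>f x\<bar> powr (\<gamma> - 1))\<^sup>2 = \<bar>f x\<bar> powr (2 * \<gamma> - 2)"
      by (simp add: power2_eq_square flip: powr_add)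
    then show "ennreal (\<gamma> * \<bar>f x\<bar> powr (\<gamma> - 1)) ^ 2 = ennreal (\<gamma>\<^sup>2 * \<bar>f x\<bar> powr (2 * \<gamma> - 2))"
      using \<gamma> by (simp add: ennreal_power power_mult_distrib)
  qed
  also have "\<dots> = ennreal (\<gamma>\<^sup>2 * S)"
    unfolding S_def using test_funs_integrable_abs_powr[OF f, of "2 * \<gamma> - 2"] \<gamma>
    by (subst nn_integral_eq_integral) auto
  also have "ennreal (\<gamma>\<^sup>2 * S) * ennreal D = ennreal (r\<^sup>2)"
    using SD by (simp add: r_def flip: ennreal_mult)
  finally have "(\<integral>\<^sup>+x. ennreal (F x) \<partial>lborel)\<^sup>2 \<le> ennreal (r\<^sup>2)" .
  moreover have r: "0 \<le> r" using SD by (simp add: r_def)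
  ultimately have Fr: "(\<integral>\<^sup>+x. ennreal (F x) \<partial>lborel) \<le> ennreal r"
  proof (cases "\<integral>\<^sup>+x. ennreal (F x) \<partial>lborel")
    case (real y)
    then have "y\<^sup>2 \<le> r\<^sup>2"
      using \<open>(\<integral>\<^sup>+x. ennreal (F x) \<partial>lborel)\<^sup>2 \<le> ennreal (r\<^sup>2)\<close> by (simp add: ennreal_power)
    then have "y \<le> r" using r by (rule power2_le_imp_le)
    then show ?thesis using real by (simp add: ennreal_leI)
  next
    case top
    then show ?thesis
      using \<open>(\<integral>\<^sup>+x. ennreal (F x) \<partial>lborel)\<^sup>2 \<le> ennreal (r\<^sup>2)\<close> by (simp add: power2_eq_square top_unique)
  qed
  have "(\<integral>\<^sup>+x. ennreal (\<bar>f x\<bar> powr (\<gamma> * (N / (N - 1)))) \<partial>lborel)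
      \<le> (\<integral>\<^sup>+x. (\<Prod>i\<in>Basis. epow (\<integral>\<^sup>+t. ennreal (F (x + t *\<^sub>R i)) \<partial>lborel) p) \<partial>lborel)"
  proof (intro nn_integral_mono)
    fix x
    have "ennreal (\<bar>f x\<bar> powr (\<gamma> * (N / (N - 1)))) = (\<Prod>i\<in>(Basis::'a set). epow (ennreal (\<bar>f x\<bar> powr \<gamma>)) p)"
    proof (cases "f x = 0")
      case True
      then show ?thesis using p \<gamma> by (simp add: epow_eq_0_iff)
    next
      case False
      then have "((\<bar>f x\<bar> powr \<gamma>) powr p) ^ DIM('a) = \<bar>f x\<bar> powr (\<gamma> * (N / (N - 1)))"
        using powr_realpow[of "(\<bar>f x\<bar> powr \<gamma>) powr p" "DIM('a)"]
        by (simp add: powr_powr p_def N_def)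
      then show ?thesis
        using p by (simp add: epow_ennreal ennreal_power)
    qed
    also have "\<dots> \<le> (\<Prod>i\<in>Basis. epow (\<integral>\<^sup>+t. ennreal (F (x + t *\<^sub>R i)) \<partial>lborel) p)"
      unfolding F_def using p \<gamma> abs_powr_le_line_integral[OF f]
      by (intro prod_mono_ennreal epow_mono) auto
    finally show "ennreal (\<bar>f x\<bar> powr (\<gamma> * (N / (N - 1)))) \<le> \<dots>" .
  qed
  also have "\<dots> \<le> epow (\<integral>\<^sup>+x. ennreal (F x) \<partial>lborel) (N / (N - 1))"
    unfolding p_def N_def using N by (intro nn_integral_prod_line_integrals_le) auto
  also have "\<dots> \<le> epow (ennreal r) (N / (N - 1))"
    using N2 Fr by (intro epow_mono) auto
  also have "\<dots> = ennreal (r powr (N / (N - 1)))"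
    using N2 r by (intro epow_ennreal) auto
  also have "r powr (N / (N - 1)) = (\<gamma>\<^sup>2 * S * D) powr (N / (2 * (N - 1)))"
  proof -
    have "r = (\<gamma>\<^sup>2 * S * D) powr (1 / 2)"
      using SD unfolding r_def by (intro powr_half_sqrt[symmetric]) auto
    then have "r powr (N / (N - 1)) = (\<gamma>\<^sup>2 * S * D) powr (1 / 2 * (N / (N - 1)))"
      by (simp only: powr_powr)
    then show ?thesis by simp
  qed
  finally show ?thesis
    using N2 \<gamma> unfolding S_def D_def
    by (subst (asm) nn_integral_eq_integral) (auto intro!: test_funs_integrable_abs_powr[OF f])
qed

text \<open>The interface between the unweighted and the weighted part: the dimension enters the
  latter only through the exponents \<open>p\<close> for which this holds. The power p/2 makes both
  sides homogeneous of degree p in f.\<close>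

definition sobolev_exponent :: "'a::euclidean_space itself \<Rightarrow> real \<Rightarrow> bool" where
  "sobolev_exponent _ p \<longleftrightarrow> (\<exists>K\<ge>0. \<forall>f\<in>(test_funs :: ('a \<Rightarrow> real) set).
     (\<integral>x. \<bar>f x\<bar> powr p \<partial>lborel) \<le> K * (\<integral>x. grad_sq f x + (f x)\<^sup>2 \<partial>lborel) powr (p / 2))"

lemma sobolev_energy_split:
  fixes f :: "'a::euclidean_space \<Rightarrow> real"
  assumes f: "f \<in> test_funs"
  shows "(\<integral>x. grad_sq f x + (f x)\<^sup>2 \<partial>lborel) = (\<integral>x. grad_sq f x \<partial>lborel) + (\<integral>x. \<bar>f x\<bar> powr 2 \<partial>lborel)"
    and "(\<integral>x. grad_sq f x \<partial>lborel) \<le> (\<integral>x. grad_sq f x + (f x)\<^sup>2 \<partial>lborel)"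
    and "(\<integral>x. \<bar>f x\<bar> powr 2 \<partial>lborel) \<le> (\<integral>x. grad_sq f x + (f x)\<^sup>2 \<partial>lborel)"
proof -
  have "(f x)\<^sup>2 = \<bar>f x\<bar> powr 2" for x by (cases "f x = 0") auto
  then show *: "(\<integral>x. grad_sq f x + (f x)\<^sup>2 \<partial>lborel) = (\<integral>x. grad_sq f x \<partial>lborel) + (\<integral>x. \<bar>f x\<bar> powr 2 \<partial>lborel)"
    using test_funs_integrable_grad_sq[OF f] test_funs_integrable_abs_powr[OF f, of 2]
    by simp
  show "(\<integral>x. grad_sq f x \<partial>lborel) \<le> (\<integral>x. grad_sq f x + (f x)\<^sup>2 \<partial>lborel)"
    "(\<integral>x. \<bar>f x\<bar> powr 2 \<partial>lborel) \<le> (\<integral>x. grad_sq f x + (f x)\<^sup>2 \<partial>lborel)"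
    unfolding * by simp_all
qed

text \<open>The value of \<gamma> solves \<gamma> N/(N - 1) = 2 \<gamma> - 2, so the same integral
  \<open>S\<close> of |f|^q stands on both sides of the Gagliardo-Nirenberg inequality. On the right
  its power is e < 1 (this is where N > 2 enters), so it can be absorbed on the left; e/(1 - e) =
  q/2 gives the stated power of the energy.\<close>

theorem sobolev_exponent_critical:
  assumes N3: "3 \<le> DIM('a::euclidean_space)"
  shows "sobolev_exponent TYPE('a) (2 * real DIM('a) / (real DIM('a) - 2))"
proof -
  define N where "N = real DIM('a)"
  define \<gamma> where "\<gamma> = 2 * (N - 1) / (N - 2)"
  define q where "q = 2 * N / (N - 2)"
  define e where "e = N / (2 * (N - 1))"
  have N: "3 \<le> N" using N3 by (simp add: N_def)
  then have *: "1 < \<gamma>" "\<gamma> * (N / (N - 1)) = q" "2 * \<gamma> - 2 = q" "0 < e" "e < 1" "e / (1 - e) = q / 2" "0 < q"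
    by (auto simp: \<gamma>_def q_def e_def divide_simps)
  have "(\<integral>x. \<bar>f x\<bar> powr q \<partial>lborel) \<le> (\<gamma>\<^sup>2) powr (q / 2) * (\<integral>x. grad_sq f x + (f x)\<^sup>2 \<partial>lborel) powr (q / 2)"
    if f: "f \<in> test_funs" for f :: "'a \<Rightarrow> real"
  proof -
    define S where "S = (\<integral>x. \<bar>f x\<bar> powr q \<partial>lborel)"
    define D where "D = (\<integral>x. grad_sq f x \<partial>lborel)"
    have nn: "0 \<le> S" "0 \<le> D" by (simp_all add: S_def D_def)
    have S: "S \<le> (\<gamma>\<^sup>2 * S * D) powr e"
      using Gagliardo_Nirenberg[OF f _ *(1)] N3 unfolding N_def[symmetric] *(2,3) S_def D_def e_def by simp
    have "S \<le> (\<gamma>\<^sup>2 * D) powr (q / 2)"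
    proof (cases "S = 0")
      case False
      then have "0 < S" using nn by simp
      have "S powr (1 - e) * S powr e = S"
        using \<open>0 < S\<close> by (simp flip: powr_add)
      also have "S \<le> ((\<gamma>\<^sup>2 * D) * S) powr e"
        using S by (simp add: mult.assoc mult.commute[of S])
      also have "\<dots> = (\<gamma>\<^sup>2 * D) powr e * S powr e"
        by (rule powr_mult)
      finally have "S powr (1 - e) * S powr e \<le> (\<gamma>\<^sup>2 * D) powr e * S powr e" .
      then have "S powr (1 - e) \<le> (\<gamma>\<^sup>2 * D) powr e"
        using \<open>0 < S\<close> by simp
      then have "(S powr (1 - e)) powr (1 / (1 - e)) \<le> ((\<gamma>\<^sup>2 * D) powr e) powr (1 / (1 - e))"
        using *(5) by (intro powr_mono2) auto
      then show ?thesis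
        using *(5,6) \<open>0 < S\<close> by (simp add: powr_powr)
    qed simp
    also have "\<dots> \<le> (\<gamma>\<^sup>2 * (\<integral>x. grad_sq f x + (f x)\<^sup>2 \<partial>lborel)) powr (q / 2)"
      using *(7) nn sobolev_energy_split(2)[OF f] unfolding D_def by (intro powr_mono2 mult_left_mono) auto
    also have "\<dots> = (\<gamma>\<^sup>2) powr (q / 2) * (\<integral>x. grad_sq f x + (f x)\<^sup>2 \<partial>lborel) powr (q / 2)"
      by (rule powr_mult)
    finally show ?thesis by (simp add: S_def)
  qed
  then show ?thesis
    unfolding sobolev_exponent_def N_def[symmetric] q_def[symmetric]
    by (intro exI[of _ "(\<gamma>\<^sup>2) powr (q / 2)"]) auto
qed

section \<open>Sobolev exponents in dimensions one and two\<close>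

lemma nn_integral_line_DIM_1:
  fixes F :: "'a::euclidean_space \<Rightarrow> ennreal"
  assumes [measurable]: "F \<in> borel_measurable borel" and N: "DIM('a) = 1" and i: "i \<in> Basis"
  shows "(\<integral>\<^sup>+t. F (x + t *\<^sub>R i) \<partial>lborel) = (\<integral>\<^sup>+y. F y \<partial>lborel)"
proof -
  interpret product_sigma_finite "\<lambda>_::'a. lborel :: real measure" ..
  have B: "Basis = {i}"
    using N i by (metis card_1_singletonE singletonD)
  have x: "x = (x \<bullet> i) *\<^sub>R i"
    using euclidean_representation[of x] by (simp add: B)
  have "(\<integral>\<^sup>+y. F y \<partial>lborel) = (\<integral>\<^sup>+w. F (w i *\<^sub>R i) \<partial>Pi\<^sub>M {i} (\<lambda>_. lborel))"
    unfolding lborel_eq[where 'a='a] B by (subst nn_integral_distr) auto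
  also have "\<dots> = (\<integral>\<^sup>+t. F (t *\<^sub>R i) \<partial>lborel)"
    by (rule product_nn_integral_singleton[where f = "\<lambda>t. F (t *\<^sub>R i)"]) measurable
  also have "\<dots> = (\<integral>\<^sup>+t. F ((x \<bullet> i + 1 * t) *\<^sub>R i) \<partial>lborel)"
    by (subst nn_integral_real_affine[where c = 1 and t = "x \<bullet> i"]) auto
  also have "\<dots> = (\<integral>\<^sup>+t. F (x + t *\<^sub>R i) \<partial>lborel)"
    by (subst (2) x) (simp add: scaleR_add_left)
  finally show ?thesis ..
qed

text \<open>The line estimate with \<gamma> = 2 bounds f^2 by the integral of 2 |f| |grad f| over
  the whole space, which is the line; then 2ab \<le> a^2 + b^2.\<close>

lemma sq_le_energy_DIM_1:
  fixes f :: "'a::euclidean_space \<Rightarrow> real"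
  assumes f: "f \<in> test_funs" and N: "DIM('a) = 1"
  shows "\<bar>f x\<bar> powr 2 \<le> (\<integral>x. grad_sq f x + (f x)\<^sup>2 \<partial>lborel)"
proof -
  obtain i :: 'a where i: "i \<in> Basis" by (meson nonempty_Basis ex_in_conv)
  have [measurable]: "f \<in> borel_measurable borel" "grad_sq f \<in> borel_measurable borel"
    using f by measurable
  have int: "integrable lborel (\<lambda>x. grad_sq f x + (f x)\<^sup>2)"
    using test_funs_integrable_grad_sq[OF f] test_funs_integrable_sq[OF f, of "\<lambda>_. 1"] by simp
  have "ennreal (\<bar>f x\<bar> powr 2) \<le> (\<integral>\<^sup>+y. ennreal (2 * \<bar>f y\<bar> powr (2 - 1) * sqrt (grad_sq f y)) \<partial>lborel)"
    using abs_powr_le_line_integral[OF f i, of 2 x]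
      nn_integral_line_DIM_1[OF _ N i, of "\<lambda>y. ennreal (2 * \<bar>f y\<bar> powr (2 - 1) * sqrt (grad_sq f y))" x]
    by simp
  also have "\<dots> \<le> (\<integral>\<^sup>+y. ennreal (grad_sq f y + (f y)\<^sup>2) \<partial>lborel)"
  proof (intro nn_integral_mono ennreal_leI)
    fix y
    show "2 * \<bar>f y\<bar> powr (2 - 1) * sqrt (grad_sq f y) \<le> grad_sq f y + (f y)\<^sup>2"
      using sum_squares_bound[of "\<bar>f y\<bar>" "sqrt (grad_sq f y)"] by (simp add: power2_eq_square)
  qed
  also have "\<dots> = ennreal (\<integral>x. grad_sq f x + (f x)\<^sup>2 \<partial>lborel)"
    using int by (intro nn_integral_eq_integral) auto
  finally show ?thesis
    by (subst (asm) ennreal_le_iff) (auto intro!: integral_nonneg_AE)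
qed

text \<open>Induction on m, each step costing a factor (m + 1)^2 times the energy, whence the
  squared factorial. In dimension two the step is Gagliardo-Nirenberg with \<gamma> = m + 1, where 2
  \<gamma> - 2 = 2m and the outer power is 1. In dimension one f^2 is bounded pointwise by the
  energy.\<close>

theorem sobolev_exponent_low_dim:
  assumes N: "DIM('a::euclidean_space) \<le> 2" and m: "0 < m"
  shows "sobolev_exponent TYPE('a) (2 * real m)"
proof -
  have "(\<integral>x. \<bar>f x\<bar> powr (2 * real m) \<partial>lborel) \<le> (fact m)\<^sup>2 * (\<integral>x. grad_sq f x + (f x)\<^sup>2 \<partial>lborel) ^ m"
    if f: "f \<in> test_funs" for f :: "'a \<Rightarrow> real"
    using m
  proof (induction m rule: nat_induct_non_zero)
    case 1
    then show ?case using sobolev_energy_split(3)[OF f] by simp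
  next
    case (Suc m)
    define H where "H = (\<integral>x. grad_sq f x + (f x)\<^sup>2 \<partial>lborel)"
    define S where "S = (\<integral>x. \<bar>f x\<bar> powr (2 * real m) \<partial>lborel)"
    have nn: "0 \<le> H" "0 \<le> S"
      by (simp_all add: H_def S_def)
    have "(\<integral>x. \<bar>f x\<bar> powr (2 * real (Suc m)) \<partial>lborel) \<le> (real (Suc m))\<^sup>2 * S * H"
    proof (cases "DIM('a) = 1")
      case True
      have "(\<integral>x. \<bar>f x\<bar> powr (2 * real (Suc m)) \<partial>lborel) \<le> (\<integral>x. H * \<bar>f x\<bar> powr (2 * real m) \<partial>lborel)"
      proof (rule integral_mono)
        fix x
        have "\<bar>f x\<bar> powr (2 * real (Suc m)) = \<bar>f x\<bar> powr 2 * \<bar>f x\<bar> powr (2 * real m)"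
          by (subst powr_add[symmetric]) (simp add: algebra_simps)
        also have "\<dots> \<le> H * \<bar>f x\<bar> powr (2 * real m)"
          using sq_le_energy_DIM_1[OF f True] by (intro mult_right_mono) (auto simp: H_def)
        finally show "\<bar>f x\<bar> powr (2 * real (Suc m)) \<le> H * \<bar>f x\<bar> powr (2 * real m)" .
      qed (use \<open>0 < m\<close> in \<open>auto intro!: test_funs_integrable_abs_powr[OF f]\<close>)
      also have "\<dots> = S * H" by (simp add: S_def)
      \<comment> \<open>Weakened to the bound that dimension two yields, so that both cases continue
        together.\<close>
      also have "\<dots> \<le> (real (Suc m))\<^sup>2 * (S * H)"
        using nn mult_right_mono[of 1 "(real (Suc m))\<^sup>2" "S * H"] by simp
      finally show ?thesis by (simp add: mult.assoc)
    next
      case False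
      then have N: "DIM('a) = 2"
        using N DIM_positive[where 'a='a] by linarith
      have "(\<integral>x. \<bar>f x\<bar> powr (2 * real (Suc m)) \<partial>lborel) \<le> (real (Suc m))\<^sup>2 * S * (\<integral>x. grad_sq f x \<partial>lborel)"
        using Gagliardo_Nirenberg[OF f, of "real (Suc m)"] \<open>0 < m\<close> nn(2) N
        by (simp add: S_def algebra_simps)
      also have "\<dots> \<le> (real (Suc m))\<^sup>2 * S * H"
        unfolding H_def using nn sobolev_energy_split(2)[OF f] by (intro mult_left_mono) auto
      finally show ?thesis .
    qed
    also have "\<dots> \<le> (real (Suc m))\<^sup>2 * ((fact m)\<^sup>2 * H ^ m) * H"
      using nn Suc.IH unfolding S_def H_def by (intro mult_left_mono mult_right_mono) auto
    finally show ?case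
      by (simp add: H_def power_mult_distrib ac_simps)
  qed
  then show ?thesis
    unfolding sobolev_exponent_def
    using m by (intro exI[of _ "(fact m)\<^sup>2"]) (auto simp: powr_realpow')
qed

section \<open>The energy norm of test functions\<close>

text \<open>A pointwise form of the triangle inequality that survives integration: minimising over t
  after integrating recovers it for the norm.\<close>

lemma weighted_diff_sq_le:
  fixes a b t :: real
  assumes "0 < t" shows "(a - b)\<^sup>2 \<le> (1 + t) * a\<^sup>2 + (1 + 1 / t) * b\<^sup>2"
proof -
  have "0 \<le> (t * a + b)\<^sup>2 / t"
    using assms by simp
  also have "(t * a + b)\<^sup>2 / t = (1 + t) * a\<^sup>2 + (1 + 1 / t) * b\<^sup>2 - (a - b)\<^sup>2"
    using assms by (simp add: field_simps power2_eq_square)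
  finally show ?thesis by simp
qed

locale potential =
  fixes V :: "'a::euclidean_space \<Rightarrow> real" and v0 :: real
  assumes V_cont: "continuous_on UNIV V" and v0_pos: "0 < v0" and v0_le: "\<And>x. v0 \<le> V x"
begin

lemma V_pos: "0 < V x"
  using v0_pos v0_le[of x] by linarith

lemma V_nonneg [simp]: "0 \<le> V x"
  using V_pos[of x] by linarith

lemma V_measurable [measurable]: "V \<in> borel_measurable borel"
  using V_cont by (rule borel_measurable_continuous_onI)

lemma integrable_energy:
  assumes "f \<in> test_funs" shows "integrable lborel (\<lambda>x. grad_sq f x + V x * (f x)\<^sup>2)"
  using test_funs_integrable_grad_sq[OF assms] test_funs_integrable_sq[OF assms V_cont] by simp

lemma V_norm_nonneg [simp]: "0 \<le> V_norm V f"
  by (simp add: V_norm_def)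

lemma V_norm_sq: "(V_norm V f)\<^sup>2 = (\<integral>x. grad_sq f x + V x * (f x)\<^sup>2 \<partial>lborel)"
  by (simp add: V_norm_def)

lemma integral_le_V_norm_sq:
  assumes f: "f \<in> test_funs"
  shows "(\<integral>x. grad_sq f x \<partial>lborel) \<le> (V_norm V f)\<^sup>2"
    and "(\<integral>x. V x * (f x)\<^sup>2 \<partial>lborel) \<le> (V_norm V f)\<^sup>2"
    and "(\<integral>x. (f x)\<^sup>2 \<partial>lborel) \<le> (V_norm V f)\<^sup>2 / v0"
    and "(\<integral>x. grad_sq f x + (f x)\<^sup>2 \<partial>lborel) \<le> (1 + 1 / v0) * (V_norm V f)\<^sup>2"
proof -
  note int = test_funs_integrable_grad_sq[OF f] test_funs_integrable_sq[OF f V_cont]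
    test_funs_integrable_sq[OF f, of "\<lambda>_. 1", simplified]
  have eq: "(V_norm V f)\<^sup>2 = (\<integral>x. grad_sq f x \<partial>lborel) + (\<integral>x. V x * (f x)\<^sup>2 \<partial>lborel)"
    unfolding V_norm_sq using int by simp
  have nn: "0 \<le> (\<integral>x. grad_sq f x \<partial>lborel)" "0 \<le> (\<integral>x. V x * (f x)\<^sup>2 \<partial>lborel)"
    by simp_all
  show 1: "(\<integral>x. grad_sq f x \<partial>lborel) \<le> (V_norm V f)\<^sup>2"
    and 2: "(\<integral>x. V x * (f x)\<^sup>2 \<partial>lborel) \<le> (V_norm V f)\<^sup>2"
    using eq nn by linarith+
  have "v0 * (\<integral>x. (f x)\<^sup>2 \<partial>lborel) = (\<integral>x. v0 * (f x)\<^sup>2 \<partial>lborel)" by simp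
  also have "\<dots> \<le> (\<integral>x. V x * (f x)\<^sup>2 \<partial>lborel)"
    using int v0_le by (intro integral_mono) (auto intro: mult_right_mono)
  finally show 3: "(\<integral>x. (f x)\<^sup>2 \<partial>lborel) \<le> (V_norm V f)\<^sup>2 / v0"
    using 2 v0_pos by (simp add: field_simps)
  show "(\<integral>x. grad_sq f x + (f x)\<^sup>2 \<partial>lborel) \<le> (1 + 1 / v0) * (V_norm V f)\<^sup>2"
    using int 1 3 by (simp add: algebra_simps)
qed

text \<open>Integrate the hypothesis and take t to be the ratio of the two norms: the right side
  becomes the square of their sum. The hypothesis is kept abstract because it covers both h = f - g
  and the decomposition of h into a difference and g.\<close>

lemma V_norm_le_add:
  assumes fgh: "f \<in> test_funs" "g \<in> test_funs" "h \<in> test_funs"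
    and le: "\<And>t x. 0 < t \<Longrightarrow> grad_sq h x + V x * (h x)\<^sup>2
      \<le> (1 + t) * (grad_sq f x + V x * (f x)\<^sup>2) + (1 + 1 / t) * (grad_sq g x + V x * (g x)\<^sup>2)"
  shows "V_norm V h \<le> V_norm V f + V_norm V g"
proof (rule field_le_epsilon)
  fix e :: real assume "0 < e"
  \<comment> \<open>Both norms are enlarged by e/2 so that t = b/a is defined and positive even if a
    norm vanishes.\<close>
  define a where "a = V_norm V f + e / 2"
  define b where "b = V_norm V g + e / 2"
  have a: "0 < a" "V_norm V f \<le> a" and b: "0 < b" "V_norm V g \<le> b"
    using \<open>0 < e\<close> by (auto simp: a_def b_def intro: add_nonneg_pos)
  have "(V_norm V h)\<^sup>2 \<le> (\<integral>x. (1 + b / a) * (grad_sq f x + V x * (f x)\<^sup>2)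
      + (1 + 1 / (b / a)) * (grad_sq g x + V x * (g x)\<^sup>2) \<partial>lborel)"
    unfolding V_norm_sq using fgh a(1) b(1)
    by (intro integral_mono le Bochner_Integration.integrable_add integrable_mult_right integrable_energy) auto
  also have "\<dots> = (1 + b / a) * (V_norm V f)\<^sup>2 + (1 + 1 / (b / a)) * (V_norm V g)\<^sup>2"
    unfolding V_norm_sq using integrable_energy[OF fgh(1)] integrable_energy[OF fgh(2)] by simp
  also have "\<dots> \<le> (1 + b / a) * a\<^sup>2 + (1 + 1 / (b / a)) * b\<^sup>2"
    using a b by (intro add_mono mult_left_mono power_mono) auto
  also have "\<dots> = (a + b)\<^sup>2"
    using a b by (simp add: field_simps power2_eq_square)
  finally show "V_norm V h \<le> V_norm V f + V_norm V g + e"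
    using power2_le_imp_le[of "V_norm V h" "a + b"] a b by (simp add: a_def b_def)
qed

lemma energy_density_diff_le:
  fixes p q :: "'a \<Rightarrow> real" and r s :: real
  assumes "0 < t"
  shows "(\<Sum>i\<in>Basis. (p i - q i)\<^sup>2) + V x * (r - s)\<^sup>2
    \<le> (1 + t) * ((\<Sum>i\<in>Basis. (p i)\<^sup>2) + V x * r\<^sup>2) + (1 + 1 / t) * ((\<Sum>i\<in>Basis. (q i)\<^sup>2) + V x * s\<^sup>2)"
proof -
  have "(\<Sum>i\<in>Basis. (p i - q i)\<^sup>2) \<le> (\<Sum>i\<in>Basis. (1 + t) * (p i)\<^sup>2 + (1 + 1 / t) * (q i)\<^sup>2)"
    by (intro sum_mono weighted_diff_sq_le assms)
  moreover have "V x * (r - s)\<^sup>2 \<le> V x * ((1 + t) * r\<^sup>2 + (1 + 1 / t) * s\<^sup>2)"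
    by (intro mult_left_mono weighted_diff_sq_le assms) auto
  ultimately show ?thesis
    by (simp only: sum.distrib sum_distrib_left[symmetric]) (simp add: algebra_simps)
qed

lemma V_norm_diff_le:
  assumes "f \<in> test_funs" "g \<in> test_funs"
  shows "V_norm V (\<lambda>x. f x - g x) \<le> V_norm V f + V_norm V g"
  using assms
  by (intro V_norm_le_add test_funs_diff)
     (auto simp: grad_sq_def frechet_derivative_diff_test_funs intro!: energy_density_diff_le)

lemma V_norm_le_diff_add:
  assumes f: "f \<in> test_funs" and g: "g \<in> test_funs"
  shows "V_norm V f \<le> V_norm V (\<lambda>x. f x - g x) + V_norm V g"
proof (intro V_norm_le_add test_funs_diff f g)
  fix t :: real and x :: 'a
  assume "0 < t"
  show "grad_sq f x + V x * (f x)\<^sup>2 \<le> (1 + t) * (grad_sq (\<lambda>x. f x - g x) x + V x * (f x - g x)\<^sup>2)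
      + (1 + 1 / t) * (grad_sq g x + V x * (g x)\<^sup>2)"
    \<comment> \<open>Here f is read as the difference (f - g) - (-g).\<close>
    using energy_density_diff_le[OF \<open>0 < t\<close>, of "\<lambda>i. frechet_derivative f (at x) i - frechet_derivative g (at x) i"
        "\<lambda>i. - frechet_derivative g (at x) i" x "f x - g x" "- g x"]
    by (simp add: grad_sq_def frechet_derivative_diff_test_funs[OF f g])
qed

end

section \<open>Local compactness\<close>

lemma nn_integral_lborel_translate:
  fixes F :: "'a::euclidean_space \<Rightarrow> ennreal"
  assumes [measurable]: "F \<in> borel_measurable borel"
  shows "(\<integral>\<^sup>+x. F (c + x) \<partial>lborel) = (\<integral>\<^sup>+x. F x \<partial>lborel)"
  by (subst (2) lborel_distr_plus[of c, symmetric]) (simp add: nn_integral_distr)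

lemma nn_integral_sq_bound:
  assumes [measurable]: "w \<in> borel_measurable M" "A \<in> sets M"
  shows "(\<integral>\<^sup>+x. ennreal \<bar>w x\<bar> * indicator A x \<partial>M)\<^sup>2
     \<le> (\<integral>\<^sup>+x. ennreal ((w x)\<^sup>2) * indicator A x \<partial>M) * emeasure M A"
proof -
  have "(\<integral>\<^sup>+x. (ennreal \<bar>w x\<bar> * indicator A x) * indicator A x \<partial>M)\<^sup>2
      \<le> (\<integral>\<^sup>+x. (ennreal \<bar>w x\<bar> * indicator A x) ^ 2 \<partial>M) * (\<integral>\<^sup>+x. indicator A x ^ 2 \<partial>M)"
    by (rule Cauchy_Schwarz_nn_integral) measurable
  also have "(\<integral>\<^sup>+x. indicator A x ^ 2 \<partial>M) = (\<integral>\<^sup>+x. indicator A x \<partial>M)"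
    by (intro nn_integral_cong) (auto simp: indicator_def)
  also have "\<dots> = emeasure M A"
    by simp
  also have "(\<integral>\<^sup>+x. (ennreal \<bar>w x\<bar> * indicator A x) ^ 2 \<partial>M) = (\<integral>\<^sup>+x. ennreal ((w x)\<^sup>2) * indicator A x \<partial>M)"
    by (intro nn_integral_cong) (auto simp: indicator_def ennreal_power)
  also have "(\<integral>\<^sup>+x. (ennreal \<bar>w x\<bar> * indicator A x) * indicator A x \<partial>M) = (\<integral>\<^sup>+x. ennreal \<bar>w x\<bar> * indicator A x \<partial>M)"
    by (intro nn_integral_cong) (auto simp: indicator_def)
  finally show ?thesis .
qed

text \<open>f(x + z) - f(x) is the integral over [0, 1] of the derivative in direction z along the
  segment. Cauchy-Schwarz on an interval of length 1 costs no constant; after Tonelli, translation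
  invariance removes the dependence on t.\<close>

lemma translation_estimate:
  fixes f :: "'a::euclidean_space \<Rightarrow> real"
  assumes f: "f \<in> test_funs"
  shows "(\<integral>\<^sup>+x. ennreal ((f (x + z) - f x)\<^sup>2) \<partial>lborel) \<le> ennreal ((norm z)\<^sup>2 * (\<integral>x. grad_sq f x \<partial>lborel))"
proof -
  have [measurable]: "f \<in> borel_measurable borel" "grad_sq f \<in> borel_measurable borel"
    using f by measurable
  have "(\<integral>\<^sup>+x. ennreal ((f (x + z) - f x)\<^sup>2) \<partial>lborel)
      \<le> (\<integral>\<^sup>+x. \<integral>\<^sup>+t. ennreal ((norm z)\<^sup>2 * grad_sq f (x + t *\<^sub>R z)) * indicator {0..1} t \<partial>lborel \<partial>lborel)"
  proof (intro nn_integral_mono)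
    fix x
    define w where "w t = frechet_derivative f (at (x + t *\<^sub>R z)) z" for t
    have w: "continuous_on UNIV w"
      unfolding w_def by (rule test_funs_line_derivative_continuous[OF f])
    then have [measurable]: "w \<in> borel_measurable borel"
      by (rule borel_measurable_continuous_onI)
    have "ennreal \<bar>f (x + 1 *\<^sub>R z) - f (x + 0 *\<^sub>R z)\<bar> \<le> (\<integral>\<^sup>+t. ennreal \<bar>w t\<bar> * indicator {0..1} t \<partial>lborel)"
      using test_funs_line_derivative[OF f, of x z] w unfolding w_def by (intro nn_integral_FTC_bound) auto
    then have "ennreal ((f (x + z) - f x)\<^sup>2) \<le> (\<integral>\<^sup>+t. ennreal \<bar>w t\<bar> * indicator {0..1} t \<partial>lborel)\<^sup>2"
      using power_mono_ennreal[where n = 2] by (fastforce simp: ennreal_power)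
    also have "\<dots> \<le> (\<integral>\<^sup>+t. ennreal ((w t)\<^sup>2) * indicator {0..1} t \<partial>lborel) * emeasure lborel {0..1::real}"
      by (rule nn_integral_sq_bound) measurable
    also have "\<dots> = (\<integral>\<^sup>+t. ennreal ((w t)\<^sup>2) * indicator {0..1} t \<partial>lborel)"
      by simp
    also have "\<dots> \<le> (\<integral>\<^sup>+t. ennreal ((norm z)\<^sup>2 * grad_sq f (x + t *\<^sub>R z)) * indicator {0..1} t \<partial>lborel)"
      unfolding w_def using frechet_derivative_sq_le[OF f]
      by (intro nn_integral_mono mult_right_mono ennreal_leI) auto
    finally show "ennreal ((f (x + z) - f x)\<^sup>2) \<le> \<dots>" .
  qed
  also have "\<dots> = (\<integral>\<^sup>+t. \<integral>\<^sup>+x. ennreal ((norm z)\<^sup>2 * grad_sq f (x + t *\<^sub>R z)) * indicator {0..1} t \<partial>lborel \<partial>lborel)"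
    by (rule pair_sigma_finite.Fubini'[OF pair_sigma_finite.intro, OF sigma_finite_lborel sigma_finite_lborel, symmetric]) measurable
  also have "\<dots> = (\<integral>\<^sup>+t. ennreal ((norm z)\<^sup>2 * (\<integral>x. grad_sq f x \<partial>lborel)) * indicator {0..1::real} t \<partial>lborel)"
  proof (intro nn_integral_cong)
    fix t :: real
    have "(\<integral>\<^sup>+x. ennreal ((norm z)\<^sup>2 * grad_sq f (x + t *\<^sub>R z)) \<partial>lborel) = (\<integral>\<^sup>+x. ennreal ((norm z)\<^sup>2 * grad_sq f x) \<partial>lborel)"
      using nn_integral_lborel_translate[of "\<lambda>x. ennreal ((norm z)\<^sup>2 * grad_sq f x)" "t *\<^sub>R z"]
      by (simp add: add.commute)
    also have "\<dots> = ennreal ((norm z)\<^sup>2 * (\<integral>x. grad_sq f x \<partial>lborel))"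
      using test_funs_integrable_grad_sq[OF f] by (subst nn_integral_eq_integral) auto
    finally show "(\<integral>\<^sup>+x. ennreal ((norm z)\<^sup>2 * grad_sq f (x + t *\<^sub>R z)) * indicator {0..1} t \<partial>lborel)
        = ennreal ((norm z)\<^sup>2 * (\<integral>x. grad_sq f x \<partial>lborel)) * indicator {0..1} t"
      by (simp add: nn_integral_multc)
  qed
  also have "\<dots> = ennreal ((norm z)\<^sup>2 * (\<integral>x. grad_sq f x \<partial>lborel))"
    by (simp add: nn_integral_cmult_indicator)
  finally show ?thesis .
qed

lemma sq_integral_le:
  fixes w :: "'b \<Rightarrow> real"
  assumes int: "integrable M (\<lambda>x. indicator A x * w x)" and [measurable]: "w \<in> borel_measurable M" "A \<in> sets M"
  shows "ennreal ((\<integral>x. indicator A x * w x \<partial>M)\<^sup>2)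
     \<le> (\<integral>\<^sup>+x. ennreal ((w x)\<^sup>2) * indicator A x \<partial>M) * emeasure M A"
proof -
  have "ennreal \<bar>\<integral>x. indicator A x * w x \<partial>M\<bar> \<le> (\<integral>\<^sup>+x. ennreal (norm (indicator A x * w x)) \<partial>M)"
    using integral_norm_bound_ennreal[OF int] by simp
  also have "\<dots> = (\<integral>\<^sup>+x. ennreal \<bar>w x\<bar> * indicator A x \<partial>M)"
    by (intro nn_integral_cong) (auto simp: indicator_def)
  finally have "ennreal \<bar>\<integral>x. indicator A x * w x \<partial>M\<bar> ^ 2 \<le> (\<integral>\<^sup>+x. ennreal \<bar>w x\<bar> * indicator A x \<partial>M)\<^sup>2"
    by (rule power_mono_ennreal)
  also have "\<dots> \<le> (\<integral>\<^sup>+x. ennreal ((w x)\<^sup>2) * indicator A x \<partial>M) * emeasure M A"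
    by (rule nn_integral_sq_bound) measurable
  finally show ?thesis by (simp add: ennreal_power)
qed

text \<open>Near a point \<open>d\<close> of the net, \<open>u\<close> is compared with its mean over \<open>ball d h\<close>; since
  \<open>ball d h \<subseteq> ball x (2 * h)\<close>, the error is controlled by translations of \<open>u\<close> by less
  than \<open>2 * h\<close>, no matter how much the balls overlap.\<close>

lemma local_L2_estimate:
  fixes u :: "'a::euclidean_space \<Rightarrow> real"
  assumes u: "u \<in> test_funs" and h: "0 < h" and F: "finite F"
    and K: "compact K" "K \<subseteq> (\<Union>d\<in>F. ball d h)"
  shows "(\<integral>x. indicator K x * (u x)\<^sup>2 \<partial>lborel)
     \<le> 2 ^ (DIM('a) + 3) * h\<^sup>2 * (\<integral>x. grad_sq u x \<partial>lborel)
       + 2 * measure lborel K / (measure lborel (ball (0::'a) h))\<^sup>2 *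
         (\<Sum>d\<in>F. (\<integral>x. indicator (ball d h) x * u x \<partial>lborel)\<^sup>2)"
proof -
  define \<beta> where "\<beta> = measure lborel (ball (0::'a) h)"
  define D where "D = (\<integral>x. grad_sq u x \<partial>lborel)"
  define a where "a d = (\<integral>x. indicator (ball d h) x * u x \<partial>lborel)" for d
  define A where "A = (\<Sum>d\<in>F. (a d)\<^sup>2)"
  define G where "G x = (\<integral>\<^sup>+z. ennreal ((u (x + z) - u x)\<^sup>2) * indicator (ball 0 (2 * h)) z \<partial>lborel)" for x
  have [measurable]: "u \<in> borel_measurable borel" using u by measurable
  have [measurable]: "K \<in> sets borel" using K(1) by (simp add: compact_imp_closed)
  have [measurable]: "ball d r \<in> sets borel" for d :: 'a and r by simp
  have \<beta>: "0 < \<beta>" "emeasure lborel (ball d h) = ennreal \<beta>" "measure lborel (ball d h) = \<beta>"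
    "emeasure lborel (ball (0::'a) (2 * h)) = ennreal (2 ^ DIM('a) * \<beta>)" for d :: 'a
    using h by (auto simp: \<beta>_def content_ball emeasure_ball power_mult_distrib ac_simps)
  have nn: "0 \<le> D" "0 \<le> A" by (auto simp: D_def A_def sum_nonneg)
  have intB: "integrable lborel (\<lambda>x. indicator (ball d h) x * u x)" for d
    using integrable_mult_indicator[of "ball d h" lborel u] test_funs_integrable[OF u, of u] test_funs_continuous[OF u]
    by simp
  \<comment> \<open>\<beta> u(x) differs from the integral \<open>a d\<close> over the nearby ball
    by the integral of u(y) - u(x) over that ball; Cauchy-Schwarz bounds the square of this
    difference by \<beta> G(x).\<close>
  have pt: "ennreal (\<beta>\<^sup>2 * (u x)\<^sup>2) \<le> ennreal (2 * \<beta>) * G x + ennreal (2 * A)" if x: "x \<in> K" for x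
  proof -
    obtain d where d: "d \<in> F" "dist d x < h" using K(2) x by (auto simp: subset_eq)
    let ?w = "\<lambda>y. u y - u x"
    have ind: "integrable lborel (\<lambda>y. indicator (ball d h) y * u x)"
      by (intro integrable_mult_left integrable_real_indicator) (simp_all add: \<beta>(2))
    have "integrable lborel (\<lambda>y. indicator (ball d h) y * ?w y)"
      using Bochner_Integration.integrable_diff[OF intB[of d] ind] by (simp add: algebra_simps)
    then have "ennreal ((\<integral>y. indicator (ball d h) y * ?w y \<partial>lborel)\<^sup>2)
       \<le> (\<integral>\<^sup>+y. ennreal ((?w y)\<^sup>2) * indicator (ball d h) y \<partial>lborel) * ennreal \<beta>"
      using sq_integral_le[of lborel "ball d h" ?w] by (simp add: \<beta>(2))
    also have "(\<integral>y. indicator (ball d h) y * ?w y \<partial>lborel) = a d - \<beta> * u x"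
      unfolding right_diff_distrib a_def using Bochner_Integration.integral_diff[OF intB[of d] ind] by (simp add: \<beta>(3))
    also have "(\<integral>\<^sup>+y. ennreal ((?w y)\<^sup>2) * indicator (ball d h) y \<partial>lborel)
        = (\<integral>\<^sup>+z. ennreal ((?w (x + z))\<^sup>2) * indicator (ball d h) (x + z) \<partial>lborel)"
      by (rule nn_integral_lborel_translate[symmetric]) measurable
    also have "\<dots> \<le> G x"
      unfolding G_def
    proof (intro nn_integral_mono mult_left_mono)
      fix z
      have "norm z < 2 * h" if "dist d (x + z) < h"
      proof -
        have "norm z = dist x (x + z)" by (simp add: dist_norm)
        also have "\<dots> \<le> dist x d + dist d (x + z)" by (rule dist_triangle)
        finally show ?thesis using that d(2) by (simp add: dist_commute)
      qed
      then show "indicator (ball d h) (x + z) \<le> (indicator (ball 0 (2 * h)) z :: ennreal)"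
        by (auto simp: indicator_def)
    qed simp
    finally have *: "ennreal ((a d - \<beta> * u x)\<^sup>2) \<le> G x * ennreal \<beta>"
      by (simp add: mult_right_mono)
    have "\<beta>\<^sup>2 * (u x)\<^sup>2 \<le> 2 * (a d - \<beta> * u x)\<^sup>2 + 2 * (a d)\<^sup>2"
      using zero_le_power2[of "2 * a d - \<beta> * u x"] by (simp add: power2_eq_square algebra_simps)
    also have "(a d)\<^sup>2 \<le> A"
      unfolding A_def using F d(1) by (intro member_le_sum) auto
    finally have "ennreal (\<beta>\<^sup>2 * (u x)\<^sup>2) \<le> ennreal (2 * (a d - \<beta> * u x)\<^sup>2 + 2 * A)"
      by (simp add: ennreal_leI)
    also have "\<dots> = 2 * ennreal ((a d - \<beta> * u x)\<^sup>2) + ennreal (2 * A)"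
      using nn by (subst ennreal_plus) (auto simp: ennreal_mult)
    also have "\<dots> \<le> 2 * (G x * ennreal \<beta>) + ennreal (2 * A)"
      by (intro add_mono mult_left_mono *) auto
    finally show ?thesis
      using \<beta>(1) by (simp add: ennreal_mult ac_simps)
  qed
  \<comment> \<open>With the order of integration exchanged, the inner integral is the translation
    estimate for one z with |z| < 2h. The ball of these z has volume 2^N \<beta>, which together
    with (2h)^2 and the factor 2 \<beta> from \<open>pt\<close> yields 2^(N + 3) h^2 after division
    by \<beta>^2.\<close>
  have "(\<integral>\<^sup>+x. G x \<partial>lborel) = (\<integral>\<^sup>+z. \<integral>\<^sup>+x. ennreal ((u (x + z) - u x)\<^sup>2) * indicator (ball 0 (2 * h)) z \<partial>lborel \<partial>lborel)"
    unfolding G_def by (rule lborel_pair.Fubini'[symmetric]) measurable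
  also have "\<dots> \<le> (\<integral>\<^sup>+z. ennreal ((2 * h)\<^sup>2 * D) * indicator (ball (0::'a) (2 * h)) z \<partial>lborel)"
  proof (intro nn_integral_mono)
    fix z :: 'a
    have "(\<integral>\<^sup>+x. ennreal ((u (x + z) - u x)\<^sup>2) * indicator (ball 0 (2 * h)) z \<partial>lborel)
      = (\<integral>\<^sup>+x. ennreal ((u (x + z) - u x)\<^sup>2) \<partial>lborel) * indicator (ball 0 (2 * h)) z"
      by (rule nn_integral_multc) measurable
    also have "\<dots> \<le> ennreal ((norm z)\<^sup>2 * D) * indicator (ball 0 (2 * h)) z"
      unfolding D_def by (intro mult_right_mono translation_estimate[OF u]) auto
    also have "\<dots> \<le> ennreal ((2 * h)\<^sup>2 * D) * indicator (ball 0 (2 * h)) z"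
    proof (cases "z \<in> ball 0 (2 * h)")
      case True
      then have "(norm z)\<^sup>2 \<le> (2 * h)\<^sup>2" by (intro power_mono) auto
      then show ?thesis using nn by (intro mult_right_mono ennreal_leI) auto
    qed simp
    finally show "(\<integral>\<^sup>+x. ennreal ((u (x + z) - u x)\<^sup>2) * indicator (ball 0 (2 * h)) z \<partial>lborel) \<le> \<dots>" .
  qed
  also have "\<dots> = ennreal ((2 * h)\<^sup>2 * D) * ennreal (2 ^ DIM('a) * \<beta>)"
    by (subst nn_integral_cmult_indicator) (auto simp only: \<beta>(4) sets_lborel borel_open open_ball)
  also have "\<dots> = ennreal ((2 * h)\<^sup>2 * D * (2 ^ DIM('a) * \<beta>))"
    using nn \<beta>(1) by (intro ennreal_mult[symmetric]) auto
  finally have G: "(\<integral>\<^sup>+x. G x \<partial>lborel) \<le> ennreal ((2 * h)\<^sup>2 * D * (2 ^ DIM('a) * \<beta>))" .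
  have [measurable]: "G \<in> borel_measurable borel"
    unfolding G_def by measurable
  have emK: "emeasure lborel K = ennreal (measure lborel K)"
    using emeasure_compact_finite[OF K(1)] by (simp add: emeasure_eq_ennreal_measure less_top)
  have intK: "integrable lborel (\<lambda>x. indicator K x * (u x)\<^sup>2)"
    using integrable_mult_indicator[of K lborel "\<lambda>x. (u x)\<^sup>2"] test_funs_integrable_sq[OF u, of "\<lambda>_. 1"] by simp
  have "ennreal (\<beta>\<^sup>2 * (\<integral>x. indicator K x * (u x)\<^sup>2 \<partial>lborel)) = (\<integral>\<^sup>+x. ennreal (\<beta>\<^sup>2 * (indicator K x * (u x)\<^sup>2)) \<partial>lborel)"
    using intK by (subst nn_integral_eq_integral) auto
  also have "\<dots> \<le> (\<integral>\<^sup>+x. ennreal (2 * \<beta>) * G x + ennreal (2 * A) * indicator K x \<partial>lborel)"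
    using pt by (intro nn_integral_mono) (auto simp: indicator_def)
  also have "\<dots> = ennreal (2 * \<beta>) * (\<integral>\<^sup>+x. G x \<partial>lborel) + ennreal (2 * A) * ennreal (measure lborel K)"
    by (simp add: nn_integral_add nn_integral_cmult nn_integral_cmult_indicator emK)
  also have "\<dots> \<le> ennreal (2 * \<beta>) * ennreal ((2 * h)\<^sup>2 * D * (2 ^ DIM('a) * \<beta>)) + ennreal (2 * A) * ennreal (measure lborel K)"
    by (intro add_mono mult_left_mono G) auto
  also have "\<dots> = ennreal (2 * \<beta> * ((2 * h)\<^sup>2 * D * (2 ^ DIM('a) * \<beta>)) + 2 * A * measure lborel K)"
  proof -
    have "ennreal p * ennreal q + ennreal s * ennreal t = ennreal (p * q + s * t)"
      if "0 \<le> p" "0 \<le> q" "0 \<le> s" "0 \<le> t" for p q s t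
      using that by (simp add: ennreal_mult)
    then show ?thesis using \<beta>(1) nn by auto
  qed
  finally have "\<beta>\<^sup>2 * (\<integral>x. indicator K x * (u x)\<^sup>2 \<partial>lborel)
      \<le> 2 * \<beta> * ((2 * h)\<^sup>2 * D * (2 ^ DIM('a) * \<beta>)) + 2 * A * measure lborel K"
    using \<beta>(1) nn h by (subst (asm) ennreal_le_iff) auto
  also have "\<dots> = \<beta>\<^sup>2 * (2 ^ (DIM('a) + 3) * h\<^sup>2 * D + 2 * measure lborel K / \<beta>\<^sup>2 * A)"
    using \<beta>(1) by (simp add: field_simps power2_eq_square power_add)
  finally have "(\<integral>x. indicator K x * (u x)\<^sup>2 \<partial>lborel) \<le> 2 ^ (DIM('a) + 3) * h\<^sup>2 * D + 2 * measure lborel K / \<beta>\<^sup>2 * A"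
    by (rule mult_left_le_imp_le) (use \<beta>(1) in simp)
  then show ?thesis
    unfolding \<beta>_def A_def D_def a_def .
qed

context potential
begin

text \<open>A diagonal argument makes the integrals over all balls with centre in a countable dense
  set and radius 1/(j + 1) converge along one subsequence. For given e a large ball K carries all
  but little of the mass, finitely many of these small balls cover K, and the local estimate applies
  to the differences.\<close>

theorem Rellich_test_funs:
  fixes \<psi> :: "nat \<Rightarrow> 'a \<Rightarrow> real"
  assumes \<psi>: "\<And>k. \<psi> k \<in> test_funs" and B: "\<And>k. V_norm V (\<psi> k) \<le> B"
    and lim: "filterlim V at_top at_infinity"
  obtains r :: "nat \<Rightarrow> nat" where "strict_mono r"
    "\<And>e. 0 < e \<Longrightarrow> \<exists>M. \<forall>m\<ge>M. \<forall>n\<ge>M. (\<integral>x. (\<psi> (r m) x - \<psi> (r n) x)\<^sup>2 \<partial>lborel) < e"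
proof -
  obtain X :: "'a set" where X: "countable X" "\<And>S. open S \<Longrightarrow> S \<noteq> {} \<Longrightarrow> \<exists>d\<in>X. d \<in> S"
    using countable_dense_exists[where 'a='a] by metis
  define \<rho> where "\<rho> j = 1 / real (Suc j)" for j
  define a where "a k = (\<lambda>(d, j). \<integral>x. indicator (ball d (\<rho> j)) x * \<psi> k x \<partial>lborel)" for k
  have \<rho>: "0 < \<rho> j" "\<rho> j \<le> 1" for j by (auto simp: \<rho>_def)
  have B0: "0 \<le> B" using order_trans[OF V_norm_nonneg B] .
  have B2: "(V_norm V (\<psi> k))\<^sup>2 \<le> B\<^sup>2" for k using B by (intro power_mono) auto
  have L2int: "integrable lborel (\<lambda>x. (f x)\<^sup>2)" if "f \<in> test_funs" for f :: "'a \<Rightarrow> real"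
    using test_funs_integrable_sq[OF that, of "\<lambda>_. 1"] by simp
  have intB: "integrable lborel (\<lambda>x. indicator (ball d h) x * \<psi> k x)" for d h k
    using integrable_mult_indicator[of "ball d h" lborel "\<psi> k"]
      test_funs_integrable[OF \<psi>[of k], of "\<psi> k"] test_funs_continuous[OF \<psi>]
    by simp
  \<comment> \<open>One bound for all balls and all k, as the diagonal extraction needs it: |\<psi>|
    \<le> 1 + \<psi>^2, and the radii do not exceed 1.\<close>
  have bound: "norm (a k s) \<le> measure lborel (ball (0::'a) 1) + B\<^sup>2 / v0" for k s
  proof (cases s)
    case (Pair d j)
    have fin: "integrable lborel (indicator (ball d (\<rho> j)) :: 'a \<Rightarrow> real)"
      using emeasure_lborel_ball_finite[of d "\<rho> j"] by (intro integrable_real_indicator) auto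
    have "norm (a k s) \<le> (\<integral>x. norm (indicator (ball d (\<rho> j)) x * \<psi> k x) \<partial>lborel)"
      unfolding a_def Pair by simp
    also have "\<dots> \<le> (\<integral>x. indicator (ball d (\<rho> j)) x + (\<psi> k x)\<^sup>2 \<partial>lborel)"
    proof (intro integral_mono integrable_norm intB Bochner_Integration.integrable_add fin L2int \<psi>)
      fix x
      have "\<bar>\<psi> k x\<bar> \<le> 1 + (\<psi> k x)\<^sup>2"
        using sum_squares_bound[of 1 "\<bar>\<psi> k x\<bar>"] by (simp add: power2_eq_square)
      then show "norm (indicator (ball d (\<rho> j)) x * \<psi> k x) \<le> indicator (ball d (\<rho> j)) x + (\<psi> k x)\<^sup>2"
        by (auto simp: indicator_def)
    qed
    also have "\<dots> = measure lborel (ball d (\<rho> j)) + (\<integral>x. (\<psi> k x)\<^sup>2 \<partial>lborel)"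
      using Bochner_Integration.integral_add[OF fin L2int[OF \<psi>]] by simp
    also have "measure lborel (ball d (\<rho> j)) \<le> measure lborel (ball (0::'a) 1)"
      using \<rho>[of j] by (simp add: content_ball less_imp_le mult_left_le power_le_one)
    also have "(\<integral>x. (\<psi> k x)\<^sup>2 \<partial>lborel) \<le> B\<^sup>2 / v0"
      using integral_le_V_norm_sq(3)[OF \<psi>, of k] B2[of k] v0_pos
      by (meson divide_right_mono less_imp_le order_trans)
    finally show ?thesis by simp
  qed
  have cnt: "countable (X \<times> (UNIV :: nat set))"
    using X(1) by (intro countable_SIGMA) auto
  obtain r where r: "strict_mono r" "\<And>s. s \<in> X \<times> UNIV \<Longrightarrow> \<exists>l. (\<lambda>n. a (r n) s) \<longlonglongrightarrow> l"
    by (rule function_convergent_subsequence[where f = a, OF cnt bound]) blast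
  have "\<exists>M. \<forall>m\<ge>M. \<forall>n\<ge>M. (\<integral>x. (\<psi> (r m) x - \<psi> (r n) x)\<^sup>2 \<partial>lborel) < e" if e: "0 < e" for e
  proof -
    \<comment> \<open>Differences have squared V-norm at most 4 B^2. Where V \<ge> \<Lambda>, u^2
      \<le> V u^2 / \<Lambda>, so the part outside K contributes at most e/4; the summand 1 keeps
      \<Lambda> positive for B = 0.\<close>
    define \<Lambda> where "\<Lambda> = 4 * (4 * B\<^sup>2 + 1) / e"
    have \<Lambda>: "0 < \<Lambda>" using e by (auto simp: \<Lambda>_def intro!: divide_pos_pos add_nonneg_pos)
    obtain R where R: "\<And>x. R \<le> norm x \<Longrightarrow> \<Lambda> \<le> V x"
      using lim by (auto simp: filterlim_at_top eventually_at_infinity)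
    \<comment> \<open>Coefficient of the squared radius in the gradient term of the local estimate;
      the radius is then taken so small that this term stays below e/4.\<close>
    define c where "c = 2 ^ (DIM('a) + 3) * (4 * B\<^sup>2 + 1)"
    have c: "0 < c" by (auto simp: c_def intro!: mult_pos_pos add_nonneg_pos)
    have "(\<lambda>j. c * (\<rho> j)\<^sup>2) \<longlonglongrightarrow> c * 0\<^sup>2"
      unfolding \<rho>_def by (intro tendsto_intros LIMSEQ_Suc[OF lim_1_over_n])
    then have "\<forall>\<^sub>F j in sequentially. c * (\<rho> j)\<^sup>2 < e / 4"
      using e by (intro order_tendstoD(2)) auto
    then obtain j where j: "c * (\<rho> j)\<^sup>2 < e / 4"
      by (auto simp: eventually_sequentially)
    define K where "K = cball (0::'a) R"
    have K: "compact K" by (simp add: K_def)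
    have "K \<subseteq> (\<Union>d\<in>X. ball d (\<rho> j))"
    proof
      fix x assume "x \<in> K"
      obtain d where "d \<in> X" "d \<in> ball x (\<rho> j)"
        using X(2)[of "ball x (\<rho> j)"] \<rho>(1)[of j] by auto
      then show "x \<in> (\<Union>d\<in>X. ball d (\<rho> j))" by (auto simp: dist_commute)
    qed
    then obtain F where F: "F \<subseteq> X" "finite F" "K \<subseteq> (\<Union>d\<in>F. ball d (\<rho> j))"
      using compactE_image[OF K, of X "\<lambda>d. ball d (\<rho> j)"] by auto
    have "\<exists>l. \<forall>d\<in>F. (\<lambda>n. a (r n) (d, j)) \<longlonglongrightarrow> l d"
      using r(2) F(1) by (intro bchoice) auto
    then obtain l where l: "\<And>d. d \<in> F \<Longrightarrow> (\<lambda>n. a (r n) (d, j)) \<longlonglongrightarrow> l d" by auto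
    define \<kappa> where "\<kappa> = 2 * measure lborel K / (measure lborel (ball (0::'a) (\<rho> j)))\<^sup>2"
    define s where "s n = (\<Sum>d\<in>F. (a (r n) (d, j) - l d)\<^sup>2)" for n
    have \<kappa>: "0 \<le> \<kappa>" by (simp add: \<kappa>_def)
    have "(\<lambda>n. 2 * \<kappa> * s n) \<longlonglongrightarrow> 2 * \<kappa> * (\<Sum>d\<in>F. (l d - l d)\<^sup>2)"
      unfolding s_def by (intro tendsto_intros l)
    \<comment> \<open>The threshold e/8 is met once for m and once for n, so the ball integrals
      contribute at most e/4. The three parts add up to 3e/4, which leaves room for the strict
      inequality.\<close>
    then have "\<forall>\<^sub>F n in sequentially. 2 * \<kappa> * s n < e / 8"
      using e by (intro order_tendstoD(2)) auto
    then obtain M where M: "\<And>n. M \<le> n \<Longrightarrow> 2 * \<kappa> * s n < e / 8"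
      by (auto simp: eventually_sequentially)
    have "(\<integral>x. (\<psi> (r m) x - \<psi> (r n) x)\<^sup>2 \<partial>lborel) < e" if mn: "M \<le> m" "M \<le> n" for m n
    proof -
      define u where "u x = \<psi> (r m) x - \<psi> (r n) x" for x
      have u: "u \<in> test_funs" unfolding u_def by (intro test_funs_diff \<psi>)
      have "V_norm V u \<le> 2 * B"
        using V_norm_diff_le[OF \<psi> \<psi>, of "r m" "r n"] B[of "r m"] B[of "r n"] unfolding u_def by linarith
      then have uB: "(V_norm V u)\<^sup>2 \<le> 4 * B\<^sup>2"
        using power_mono[of "V_norm V u" "2 * B" 2] by (simp add: power_mult_distrib)
      have intK: "integrable lborel (\<lambda>x. indicator K x * (u x)\<^sup>2)"
        using integrable_mult_indicator[of K lborel "\<lambda>x. (u x)\<^sup>2"] L2int[OF u] by (simp add: K_def)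
      have intV: "integrable lborel (\<lambda>x. V x * (u x)\<^sup>2 / \<Lambda>)"
        using test_funs_integrable_sq[OF u V_cont] by simp
      have "(\<integral>x. (u x)\<^sup>2 \<partial>lborel) \<le> (\<integral>x. indicator K x * (u x)\<^sup>2 + V x * (u x)\<^sup>2 / \<Lambda> \<partial>lborel)"
      proof (intro integral_mono L2int u Bochner_Integration.integrable_add intK intV)
        fix x
        show "(u x)\<^sup>2 \<le> indicator K x * (u x)\<^sup>2 + V x * (u x)\<^sup>2 / \<Lambda>"
        proof (cases "x \<in> K")
          case False
          then have "\<Lambda> * (u x)\<^sup>2 \<le> V x * (u x)\<^sup>2" using R[of x] by (intro mult_right_mono) (auto simp: K_def)
          then show ?thesis using False \<Lambda> by (simp add: field_simps)
        qed (use \<Lambda> in simp)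
      qed
      also have "\<dots> = (\<integral>x. indicator K x * (u x)\<^sup>2 \<partial>lborel) + (\<integral>x. V x * (u x)\<^sup>2 \<partial>lborel) / \<Lambda>"
        using Bochner_Integration.integral_add[OF intK intV] by simp
      also have "(\<integral>x. V x * (u x)\<^sup>2 \<partial>lborel) / \<Lambda> \<le> e / 4"
      proof -
        have "(\<integral>x. V x * (u x)\<^sup>2 \<partial>lborel) \<le> 4 * B\<^sup>2 + 1"
          using integral_le_V_norm_sq(2)[OF u] uB by linarith
        also have "\<dots> = e / 4 * \<Lambda>" using e by (simp add: \<Lambda>_def)
        finally show ?thesis using \<Lambda> by (simp add: field_simps)
      qed
      also have "(\<integral>x. indicator K x * (u x)\<^sup>2 \<partial>lborel) \<le> 2 ^ (DIM('a) + 3) * (\<rho> j)\<^sup>2 * (\<integral>x. grad_sq u x \<partial>lborel)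
          + \<kappa> * (\<Sum>d\<in>F. (\<integral>x. indicator (ball d (\<rho> j)) x * u x \<partial>lborel)\<^sup>2)"
        unfolding \<kappa>_def by (intro local_L2_estimate u \<rho> F K)
      also have "2 ^ (DIM('a) + 3) * (\<rho> j)\<^sup>2 * (\<integral>x. grad_sq u x \<partial>lborel) \<le> 2 ^ (DIM('a) + 3) * (\<rho> j)\<^sup>2 * (4 * B\<^sup>2 + 1)"
        using integral_le_V_norm_sq(1)[OF u] uB by (intro mult_left_mono) auto
      also have "\<dots> = c * (\<rho> j)\<^sup>2" by (simp add: c_def)
      also have "\<dots> \<le> e / 4" using j by simp
      also have "(\<Sum>d\<in>F. (\<integral>x. indicator (ball d (\<rho> j)) x * u x \<partial>lborel)\<^sup>2) \<le> (\<Sum>d\<in>F. 2 * (a (r m) (d, j) - l d)\<^sup>2 + 2 * (a (r n) (d, j) - l d)\<^sup>2)"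
      proof (intro sum_mono)
        fix d
        have "(\<integral>x. indicator (ball d (\<rho> j)) x * u x \<partial>lborel) = a (r m) (d, j) - a (r n) (d, j)"
          unfolding u_def a_def right_diff_distrib
          using Bochner_Integration.integral_diff[OF intB intB] by simp
        moreover have "(p - q)\<^sup>2 \<le> 2 * (p - y)\<^sup>2 + 2 * (q - y)\<^sup>2" for p q y :: real
          using zero_le_power2[of "p + q - 2 * y"] by (simp add: power2_eq_square algebra_simps)
        ultimately show "(\<integral>x. indicator (ball d (\<rho> j)) x * u x \<partial>lborel)\<^sup>2 \<le> 2 * (a (r m) (d, j) - l d)\<^sup>2 + 2 * (a (r n) (d, j) - l d)\<^sup>2"
          by simp
      qed
      also have "\<dots> = 2 * s m + 2 * s n"
        by (simp add: s_def sum.distrib sum_distrib_left)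
      also have "\<kappa> * (2 * s m + 2 * s n) < e / 4"
        using M[OF mn(1)] M[OF mn(2)] by (simp add: algebra_simps)
      finally have "(\<integral>x. (u x)\<^sup>2 \<partial>lborel) \<le> e / 4 + e / 4 + e / 4"
        using \<kappa> by (simp add: mult_left_mono)
      then show ?thesis using e by (simp add: u_def)
    qed
    then show ?thesis by blast
  qed
  with r(1) show ?thesis by (rule that)
qed

end

section \<open>Weighted embeddings\<close>

text \<open>Every passage from test functions to a limit goes through this form of Fatou's lemma.
  The bounds may vary with n because the V-norms of an approximating sequence only converge, and
  need hold only eventually because Cauchy conditions give no more.\<close>

lemma nn_integral_Fatou_bound:
  fixes f :: "nat \<Rightarrow> 'b \<Rightarrow> ennreal"
  assumes [measurable]: "\<And>n. f n \<in> borel_measurable M"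
    and lim: "AE x in M. (\<lambda>n. f n x) \<longlonglongrightarrow> g x"
    and le: "\<forall>\<^sub>F n in sequentially. (\<integral>\<^sup>+x. f n x \<partial>M) \<le> C n" and C: "C \<longlonglongrightarrow> L"
  shows "(\<integral>\<^sup>+x. g x \<partial>M) \<le> L"
proof -
  have "(\<integral>\<^sup>+x. g x \<partial>M) = (\<integral>\<^sup>+x. liminf (\<lambda>n. f n x) \<partial>M)"
    using lim by (intro nn_integral_cong_AE) (auto elim!: eventually_mono simp: lim_imp_Liminf)
  also have "\<dots> \<le> liminf (\<lambda>n. \<integral>\<^sup>+x. f n x \<partial>M)"
    by (rule nn_integral_liminf) measurable
  also have "\<dots> \<le> liminf C"
    using le by (rule Liminf_mono)
  also have "\<dots> = L"
    using C by (simp add: lim_imp_Liminf)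
  finally show ?thesis .
qed

text \<open>Along a subsequence with \<open>\<integral>(s (r (n+1)) - s (r n))\<^sup>2 < 4\<^sup>-\<^sup>n\<close> the series
  \<open>\<Sum>2\<^sup>n (s (r (n+1)) - s (r n))\<^sup>2\<close> converges almost everywhere, so the increments decay
  geometrically.\<close>

lemma L2_Cauchy_AE_subseq:
  fixes s :: "nat \<Rightarrow> 'b \<Rightarrow> real"
  assumes [measurable]: "\<And>n. s n \<in> borel_measurable M"
    and int: "\<And>m n. integrable M (\<lambda>x. (s m x - s n x)\<^sup>2)"
    and Cauchy: "\<And>e. 0 < e \<Longrightarrow> \<exists>N. \<forall>m\<ge>N. \<forall>n\<ge>N. (\<integral>x. (s m x - s n x)\<^sup>2 \<partial>M) < e"
  obtains r :: "nat \<Rightarrow> nat" where "strict_mono r" "AE x in M. convergent (\<lambda>n. s (r n) x)"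
proof -
  have "\<exists>r. \<forall>n. (\<forall>i\<ge>r n. \<forall>j\<ge>r n. (\<integral>x. (s i x - s j x)\<^sup>2 \<partial>M) < (1 / 4) ^ n) \<and> r n < r (Suc n)"
  proof (intro dependent_nat_choice)
    show "\<exists>k. \<forall>i\<ge>k. \<forall>j\<ge>k. (\<integral>x. (s i x - s j x)\<^sup>2 \<partial>M) < (1 / 4) ^ 0"
      using Cauchy[of 1] by simp
  next
    fix k n
    obtain N where "\<forall>i\<ge>N. \<forall>j\<ge>N. (\<integral>x. (s i x - s j x)\<^sup>2 \<partial>M) < (1 / 4) ^ Suc n"
      using Cauchy[of "(1 / 4) ^ Suc n"] by auto
    then show "\<exists>l. (\<forall>i\<ge>l. \<forall>j\<ge>l. (\<integral>x. (s i x - s j x)\<^sup>2 \<partial>M) < (1 / 4) ^ Suc n) \<and> k < l"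
      by (intro exI[of _ "max N (Suc k)"]) auto
  qed
  then obtain r where r: "\<And>n i j. r n \<le> i \<Longrightarrow> r n \<le> j \<Longrightarrow> (\<integral>x. (s i x - s j x)\<^sup>2 \<partial>M) < (1 / 4) ^ n"
    "\<And>n. r n < r (Suc n)" by auto
  define d where "d n x = s (r (Suc n)) x - s (r n) x" for n x
  have [measurable]: "d n \<in> borel_measurable M" for n
    unfolding d_def by measurable
  have "(\<integral>\<^sup>+x. (\<Sum>n. ennreal (2 ^ n * (d n x)\<^sup>2)) \<partial>M) = (\<Sum>n. \<integral>\<^sup>+x. ennreal (2 ^ n * (d n x)\<^sup>2) \<partial>M)"
    by (rule nn_integral_suminf) measurable
  also have "\<dots> \<le> (\<Sum>n. ennreal ((1 / 2) ^ n))"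
  proof (intro suminf_le)
    fix n
    have "(\<integral>\<^sup>+x. ennreal (2 ^ n * (d n x)\<^sup>2) \<partial>M) = ennreal (2 ^ n * (\<integral>x. (d n x)\<^sup>2 \<partial>M))"
      unfolding d_def using int by (subst nn_integral_eq_integral) auto
    also have "(\<integral>x. (d n x)\<^sup>2 \<partial>M) \<le> (1 / 4) ^ n"
      unfolding d_def using r(1)[of n "r (Suc n)" "r n"] r(2)[of n] by simp
    also have "2 ^ n * (1 / 4) ^ n = ((1 / 2) ^ n :: real)"
      by (simp flip: power_mult_distrib)
    finally show "(\<integral>\<^sup>+x. ennreal (2 ^ n * (d n x)\<^sup>2) \<partial>M) \<le> ennreal ((1 / 2) ^ n)"
      by (simp add: ennreal_leI)
  qed auto
  also have "\<dots> = ennreal (\<Sum>n. (1 / 2) ^ n)"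
    by (intro suminf_ennreal2) (auto intro!: summable_geometric)
  also have "\<dots> < \<infinity>" by simp
  finally have "(\<integral>\<^sup>+x. (\<Sum>n. ennreal (2 ^ n * (d n x)\<^sup>2)) \<partial>M) \<noteq> \<infinity>" by simp
  then have "AE x in M. (\<Sum>n. ennreal (2 ^ n * (d n x)\<^sup>2)) \<noteq> \<infinity>"
    by (intro nn_integral_noteq_infinite) measurable
  then have "AE x in M. convergent (\<lambda>n. s (r n) x)"
  proof eventually_elim
    case (elim x)
    define c where "c = enn2real (\<Sum>n. ennreal (2 ^ n * (d n x)\<^sup>2))"
    have c: "0 \<le> c" "(\<Sum>n. ennreal (2 ^ n * (d n x)\<^sup>2)) = ennreal c"
      using elim by (simp_all add: c_def less_top)
    have "\<bar>d n x\<bar> \<le> sqrt c * (1 / sqrt 2) ^ n" for n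
    proof -
      \<comment> \<open>A single term of the convergent series is at most its sum c, which gives
        d_n^2 \<le> c 2^-n and hence a geometric majorant for the increments.\<close>
      have "(\<Sum>k\<in>{n}. ennreal (2 ^ k * (d k x)\<^sup>2)) \<le> (\<Sum>k. ennreal (2 ^ k * (d k x)\<^sup>2))"
        by (rule sum_le_suminf) auto
      then have "2 ^ n * (d n x)\<^sup>2 \<le> c"
        unfolding c(2) using c(1) by simp
      then have "(d n x)\<^sup>2 \<le> c * (1 / 2) ^ n"
        by (simp add: field_simps)
      then have "\<bar>d n x\<bar> \<le> sqrt (c * (1 / 2) ^ n)"
        by (intro real_le_rsqrt) simp
      also have "\<dots> = sqrt c * (1 / sqrt 2) ^ n"
        by (simp add: real_sqrt_mult real_sqrt_power real_sqrt_divide)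
      finally show ?thesis .
    qed
    moreover have "summable (\<lambda>n. sqrt c * (1 / sqrt 2) ^ n)"
      by (intro summable_mult summable_geometric) auto
    ultimately have "summable (\<lambda>n. d n x)"
      by (intro summable_comparison_test[of "\<lambda>n. d n x" "\<lambda>n. sqrt c * (1 / sqrt 2) ^ n"]) auto
    then have "convergent (\<lambda>n. \<Sum>k<n. d k x)"
      by (simp add: summable_iff_convergent)
    then have "convergent (\<lambda>n. (\<Sum>k<n. d k x) + s (r 0) x)"
      by (intro convergent_add convergent_const)
    moreover have "(\<lambda>n. (\<Sum>k<n. d k x) + s (r 0) x) = (\<lambda>n. s (r n) x)"
      unfolding d_def using sum_lessThan_telescope[of "\<lambda>n. s (r n) x"] by auto
    ultimately show ?case by simp
  qed
  moreover have "strict_mono r" using r(2) by (simp add: strict_mono_Suc_iff)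
  ultimately show ?thesis by (intro that)
qed

lemma abs_diff_powr_le:
  fixes a b \<tau> :: real assumes "0 \<le> \<tau>"
  shows "\<bar>a - b\<bar> powr \<tau> \<le> 2 powr \<tau> * (\<bar>a\<bar> powr \<tau> + \<bar>b\<bar> powr \<tau>)"
proof -
  have "\<bar>a - b\<bar> powr \<tau> \<le> (2 * max \<bar>a\<bar> \<bar>b\<bar>) powr \<tau>"
    using assms by (intro powr_mono2) auto
  also have "\<dots> = 2 powr \<tau> * max \<bar>a\<bar> \<bar>b\<bar> powr \<tau>"
    by (rule powr_mult)
  also have "\<dots> \<le> 2 powr \<tau> * (\<bar>a\<bar> powr \<tau> + \<bar>b\<bar> powr \<tau>)"
    by (intro mult_left_mono) (auto simp: max_def)
  finally show ?thesis .
qed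

text \<open>Dividing by K + 1 rather than K treats K = 0 together with K > 0 when a small parameter
  is chosen.\<close>

lemma mult_divide_add_one_le:
  fixes K e :: real assumes "0 \<le> K" "0 \<le> e" shows "K * (e / (K + 1)) \<le> e"
  using assms by (simp add: field_simps)

locale weighted_potential = potential V v0
  for V :: "'a::euclidean_space \<Rightarrow> real" and v0 :: real +
  fixes W :: "'a \<Rightarrow> real" and \<alpha> C :: real
  assumes W_cont: "continuous_on UNIV W" and W_nonneg: "\<And>x. 0 \<le> W x"
    and W_le: "\<And>x. W x \<le> C * V x powr \<alpha>" and \<alpha>: "0 < \<alpha>" "\<alpha> < 1" and C_nonneg: "0 \<le> C"
begin

lemma W_measurable [measurable]: "W \<in> borel_measurable borel"
  using W_cont by (rule borel_measurable_continuous_onI)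

text \<open>Pointwise, W |u|^\<tau> \<le> C (V u^2)^\<alpha> (u^2)^b (|u|^p)^d: the relation for
  \<tau> says that the powers of u agree. Then Hoelder's inequality with three weights.\<close>

lemma weighted_Hoelder:
  assumes [measurable]: "u \<in> borel_measurable borel"
    and bd: "0 \<le> b" "0 \<le> d" "\<alpha> + b + d = 1" and \<tau>: "\<tau> = 2 * \<alpha> + 2 * b + p * d"
  shows "(\<integral>\<^sup>+x. ennreal (W x * \<bar>u x\<bar> powr \<tau>) \<partial>lborel) \<le> ennreal C *
    (epow (\<integral>\<^sup>+x. ennreal (V x * (u x)\<^sup>2) \<partial>lborel) \<alpha> *
      (epow (\<integral>\<^sup>+x. ennreal ((u x)\<^sup>2) \<partial>lborel) b * epow (\<integral>\<^sup>+x. ennreal (\<bar>u x\<bar> powr p) \<partial>lborel) d))"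
proof -
  have "(\<integral>\<^sup>+x. ennreal (W x * \<bar>u x\<bar> powr \<tau>) \<partial>lborel) \<le> (\<integral>\<^sup>+x. ennreal C *
      (epow (ennreal (V x * (u x)\<^sup>2)) \<alpha> * (epow (ennreal ((u x)\<^sup>2)) b * epow (ennreal (\<bar>u x\<bar> powr p)) d)) \<partial>lborel)"
  proof (intro nn_integral_mono)
    fix x
    show "ennreal (W x * \<bar>u x\<bar> powr \<tau>) \<le> ennreal C *
      (epow (ennreal (V x * (u x)\<^sup>2)) \<alpha> * (epow (ennreal ((u x)\<^sup>2)) b * epow (ennreal (\<bar>u x\<bar> powr p)) d))"
    \<comment> \<open>At a zero of u the left side is 0. Elsewhere all bases are positive, so
      \<open>epow\<close> agrees with \<open>powr\<close> even if b or d is 0.\<close>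
    proof (cases "u x = 0")
      case False
      have sq: "(u x)\<^sup>2 = \<bar>u x\<bar> powr 2" using False by simp
      have "W x * \<bar>u x\<bar> powr \<tau> \<le> C * V x powr \<alpha> * \<bar>u x\<bar> powr \<tau>"
        using W_le by (intro mult_right_mono) auto
      also have "\<dots> = C * ((V x * (u x)\<^sup>2) powr \<alpha> * (((u x)\<^sup>2) powr b * (\<bar>u x\<bar> powr p) powr d))"
        unfolding \<tau> sq using V_pos[of x] False by (simp only: powr_mult powr_powr powr_add mult.assoc)
      finally have "ennreal (W x * \<bar>u x\<bar> powr \<tau>)
        \<le> ennreal (C * ((V x * (u x)\<^sup>2) powr \<alpha> * (((u x)\<^sup>2) powr b * (\<bar>u x\<bar> powr p) powr d)))"
        by (rule ennreal_leI)
      also have "\<dots> = ennreal C *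
        (epow (ennreal (V x * (u x)\<^sup>2)) \<alpha> * (epow (ennreal ((u x)\<^sup>2)) b * epow (ennreal (\<bar>u x\<bar> powr p)) d))"
        using V_pos[of x] False C_nonneg by (simp only: epow_ennreal_pos zero_less_power2 mult_pos_pos powr_gt_zero
          abs_eq_0 not_False_eq_True) (simp add: ennreal_mult)
      finally show ?thesis .
    qed simp
  qed
  also have "\<dots> = ennreal C * (\<integral>\<^sup>+x. epow (ennreal (V x * (u x)\<^sup>2)) \<alpha> *
      (epow (ennreal ((u x)\<^sup>2)) b * epow (ennreal (\<bar>u x\<bar> powr p)) d) \<partial>lborel)"
    by (rule nn_integral_cmult) measurable
  also have "\<dots> \<le> ennreal C *
    (epow (\<integral>\<^sup>+x. ennreal (V x * (u x)\<^sup>2) \<partial>lborel) \<alpha> *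
      (epow (\<integral>\<^sup>+x. ennreal ((u x)\<^sup>2) \<partial>lborel) b * epow (\<integral>\<^sup>+x. ennreal (\<bar>u x\<bar> powr p) \<partial>lborel) d))"
    using bd \<alpha> by (intro mult_left_mono nn_integral_Hoelder3) auto
  finally show ?thesis .
qed

text \<open>The L^2 factor is kept apart from the energy: estimating it by the energy gives the
  continuous embedding, keeping it gives compactness.\<close>

lemma test_funs_weighted_bound:
  assumes S: "sobolev_exponent TYPE('a) p" and p: "2 \<le> p"
    and bd: "0 \<le> b" "0 \<le> d" "\<alpha> + b + d = 1" and \<tau>: "\<tau> = 2 * \<alpha> + 2 * b + p * d"
  obtains K where "0 \<le> K" "\<And>u. u \<in> test_funs \<Longrightarrow>
    (\<integral>\<^sup>+x. ennreal (W x * \<bar>u x\<bar> powr \<tau>) \<partial>lborel) \<le> ennreal K *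
      (epow (ennreal ((V_norm V u)\<^sup>2)) (\<alpha> + p / 2 * d) * epow (ennreal (\<integral>x. (u x)\<^sup>2 \<partial>lborel)) b)"
proof -
  obtain K0 where K0: "0 \<le> K0" "\<And>f :: 'a \<Rightarrow> real. f \<in> test_funs \<Longrightarrow>
      (\<integral>x. \<bar>f x\<bar> powr p \<partial>lborel) \<le> K0 * (\<integral>x. grad_sq f x + (f x)\<^sup>2 \<partial>lborel) powr (p / 2)"
    using S by (auto simp: sobolev_exponent_def)
  define K1 where "K1 = K0 * (1 + 1 / v0) powr (p / 2)"
  have K1: "0 \<le> K1" using K0(1) by (simp add: K1_def)
  \<comment> \<open>The constant is formed with \<open>epow\<close> because d may be 0; it is finite
    and therefore a real number.\<close>
  define K2 where "K2 = ennreal C * epow (ennreal K1) d"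
  have "K2 \<noteq> top"
    using bd(2) by (auto simp: K2_def ennreal_mult_eq_top_iff epow_eq_top_iff)
  then obtain K where K: "0 \<le> K" "K2 = ennreal K" by (cases K2) auto
  show ?thesis
  proof (rule that[OF K(1)])
    fix u :: "'a \<Rightarrow> real" assume u: "u \<in> test_funs"
    have [measurable]: "u \<in> borel_measurable borel" using u by measurable
    define E where "E = ennreal ((V_norm V u)\<^sup>2)"
    have 1: "(\<integral>\<^sup>+x. ennreal (V x * (u x)\<^sup>2) \<partial>lborel) \<le> E"
      unfolding E_def using test_funs_integrable_sq[OF u V_cont] integral_le_V_norm_sq(2)[OF u]
      by (subst nn_integral_eq_integral) (auto intro: ennreal_leI)
    have 2: "(\<integral>\<^sup>+x. ennreal ((u x)\<^sup>2) \<partial>lborel) = ennreal (\<integral>x. (u x)\<^sup>2 \<partial>lborel)"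
      using test_funs_integrable_sq[OF u, of "\<lambda>_. 1"] by (subst nn_integral_eq_integral) auto
    have "(\<integral>x. \<bar>u x\<bar> powr p \<partial>lborel) \<le> K0 * (\<integral>x. grad_sq u x + (u x)\<^sup>2 \<partial>lborel) powr (p / 2)"
      by (rule K0(2)[OF u])
    also have "\<dots> \<le> K0 * ((1 + 1 / v0) * (V_norm V u)\<^sup>2) powr (p / 2)"
      using K0(1) p integral_le_V_norm_sq(4)[OF u] by (intro mult_left_mono powr_mono2) auto
    also have "\<dots> = K1 * ((V_norm V u)\<^sup>2) powr (p / 2)"
      unfolding K1_def powr_mult by simp
    finally have "ennreal (\<integral>x. \<bar>u x\<bar> powr p \<partial>lborel) \<le> ennreal (K1 * ((V_norm V u)\<^sup>2) powr (p / 2))"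
      by (rule ennreal_leI)
    also have "\<dots> = ennreal K1 * epow E (p / 2)"
      unfolding E_def using K1 p by (simp add: ennreal_mult epow_ennreal)
    finally have 3: "(\<integral>\<^sup>+x. ennreal (\<bar>u x\<bar> powr p) \<partial>lborel) \<le> ennreal K1 * epow E (p / 2)"
      using test_funs_integrable_abs_powr[OF u, of p] p by (subst nn_integral_eq_integral) auto
    have "(\<integral>\<^sup>+x. ennreal (W x * \<bar>u x\<bar> powr \<tau>) \<partial>lborel) \<le> ennreal C *
      (epow (\<integral>\<^sup>+x. ennreal (V x * (u x)\<^sup>2) \<partial>lborel) \<alpha> *
        (epow (\<integral>\<^sup>+x. ennreal ((u x)\<^sup>2) \<partial>lborel) b * epow (\<integral>\<^sup>+x. ennreal (\<bar>u x\<bar> powr p) \<partial>lborel) d))"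
      by (rule weighted_Hoelder[OF _ bd \<tau>]) measurable
    also have "\<dots> \<le> ennreal C * (epow E \<alpha> *
        (epow (ennreal (\<integral>x. (u x)\<^sup>2 \<partial>lborel)) b * epow (ennreal K1 * epow E (p / 2)) d))"
      unfolding 2 using bd \<alpha> by (intro mult_mono epow_mono 1 3) auto
    also have "\<dots> = K2 * (epow E (\<alpha> + p / 2 * d) * epow (ennreal (\<integral>x. (u x)\<^sup>2 \<partial>lborel)) b)"
      using bd \<alpha> p by (simp add: K2_def epow_mult epow_epow epow_add ac_simps)
    finally show "(\<integral>\<^sup>+x. ennreal (W x * \<bar>u x\<bar> powr \<tau>) \<partial>lborel) \<le> ennreal K *
      (epow (ennreal ((V_norm V u)\<^sup>2)) (\<alpha> + p / 2 * d) * epow (ennreal (\<integral>x. (u x)\<^sup>2 \<partial>lborel)) b)"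
      by (simp add: K(2) E_def)
  qed
qed

lemma test_funs_embedding:
  assumes S: "sobolev_exponent TYPE('a) p" and p: "2 \<le> p"
    and bd: "0 \<le> b" "0 \<le> d" "\<alpha> + b + d = 1" and \<tau>: "\<tau> = 2 * \<alpha> + 2 * b + p * d"
  obtains K where "0 \<le> K" "\<And>u. u \<in> test_funs \<Longrightarrow>
    (\<integral>\<^sup>+x. ennreal (W x * \<bar>u x\<bar> powr \<tau>) \<partial>lborel) \<le> ennreal (K * V_norm V u powr \<tau>)"
proof -
  obtain K0 where K0: "0 \<le> K0" "\<And>u. u \<in> test_funs \<Longrightarrow>
    (\<integral>\<^sup>+x. ennreal (W x * \<bar>u x\<bar> powr \<tau>) \<partial>lborel) \<le> ennreal K0 *
      (epow (ennreal ((V_norm V u)\<^sup>2)) (\<alpha> + p / 2 * d) * epow (ennreal (\<integral>x. (u x)\<^sup>2 \<partial>lborel)) b)"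
    by (rule test_funs_weighted_bound[OF assms]) blast
  have \<tau>0: "0 < \<tau>" using \<tau> bd \<alpha> p by (auto intro: add_pos_nonneg)
  have e: "0 \<le> \<alpha> + p / 2 * d" using \<alpha> p bd by simp
  have "ennreal K0 * epow (ennreal (1 / v0)) b \<noteq> top"
    using bd(1) by (auto simp: ennreal_mult_eq_top_iff epow_eq_top_iff)
  then obtain K where K: "0 \<le> K" "ennreal K0 * epow (ennreal (1 / v0)) b = ennreal K"
    by (cases "ennreal K0 * epow (ennreal (1 / v0)) b") auto
  show ?thesis
  proof (rule that[OF K(1)])
    fix u :: "'a \<Rightarrow> real" assume u: "u \<in> test_funs"
    define E where "E = (V_norm V u)\<^sup>2"
    note K0(2)[OF u]
    also have "ennreal K0 * (epow (ennreal ((V_norm V u)\<^sup>2)) (\<alpha> + p / 2 * d) * epow (ennreal (\<integral>x. (u x)\<^sup>2 \<partial>lborel)) b)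
      \<le> ennreal K0 * (epow (ennreal E) (\<alpha> + p / 2 * d) * epow (ennreal (1 / v0) * ennreal E) b)"
      using integral_le_V_norm_sq(3)[OF u] bd(1) v0_pos e unfolding E_def
      by (intro mult_mono epow_mono) (auto intro!: ennreal_leI simp flip: ennreal_mult)
    also have "\<dots> = ennreal K * epow (ennreal E) (\<alpha> + p / 2 * d + b)"
      unfolding K(2)[symmetric] using bd \<alpha> p by (simp add: epow_mult epow_add ac_simps)
    \<comment> \<open>The relation for \<tau> says precisely that the total power of the squared
      norm is \<tau>/2, as homogeneity demands.\<close>
    also have "\<alpha> + p / 2 * d + b = \<tau> / 2" by (simp add: \<tau> field_simps)
    also have "epow (ennreal E) (\<tau> / 2) = ennreal (V_norm V u powr \<tau>)"
    proof (cases "V_norm V u = 0")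
      case False
      then have "E = V_norm V u powr 2" unfolding E_def by (simp add: order.not_eq_order_implies_strict)
      then have "E powr (\<tau> / 2) = V_norm V u powr (2 * (\<tau> / 2))" by (simp only: powr_powr)
      then show ?thesis using \<tau>0 by (simp add: epow_ennreal E_def)
    qed (use \<tau>0 in \<open>simp add: E_def epow_eq_0_iff\<close>)
    finally show "(\<integral>\<^sup>+x. ennreal (W x * \<bar>u x\<bar> powr \<tau>) \<partial>lborel) \<le> ennreal (K * V_norm V u powr \<tau>)"
      using K(1) by (simp add: ennreal_mult)
  qed
qed

text \<open>On a set of bounded energy, smallness in L^2 forces smallness in L^\<tau>_W, at the rate
  given by the positive power b.\<close>

lemma test_funs_interpolation:
  assumes S: "sobolev_exponent TYPE('a) p" and p: "2 \<le> p"
    and bd: "0 < b" "0 \<le> d" "\<alpha> + b + d = 1" and \<tau>: "\<tau> = 2 * \<alpha> + 2 * b + p * d"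
  obtains K where "0 \<le> K" "\<And>u. u \<in> test_funs \<Longrightarrow> V_norm V u \<le> B \<Longrightarrow>
    (\<integral>\<^sup>+x. ennreal (W x * \<bar>u x\<bar> powr \<tau>) \<partial>lborel) \<le> ennreal (K * (\<integral>x. (u x)\<^sup>2 \<partial>lborel) powr b)"
proof -
  have b: "0 \<le> b" using bd by simp
  obtain K0 where K0: "0 \<le> K0" "\<And>u. u \<in> test_funs \<Longrightarrow>
    (\<integral>\<^sup>+x. ennreal (W x * \<bar>u x\<bar> powr \<tau>) \<partial>lborel) \<le> ennreal K0 *
      (epow (ennreal ((V_norm V u)\<^sup>2)) (\<alpha> + p / 2 * d) * epow (ennreal (\<integral>x. (u x)\<^sup>2 \<partial>lborel)) b)"
    by (rule test_funs_weighted_bound[OF S p b bd(2,3) \<tau>]) blast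
  have e: "0 \<le> \<alpha> + p / 2 * d" using \<alpha> p bd by simp
  have "ennreal K0 * epow (ennreal (B\<^sup>2)) (\<alpha> + p / 2 * d) \<noteq> top"
    using e by (auto simp: ennreal_mult_eq_top_iff epow_eq_top_iff)
  then obtain K where K: "0 \<le> K" "ennreal K0 * epow (ennreal (B\<^sup>2)) (\<alpha> + p / 2 * d) = ennreal K"
    by (cases "ennreal K0 * epow (ennreal (B\<^sup>2)) (\<alpha> + p / 2 * d)") auto
  show ?thesis
  proof (rule that[OF K(1)])
    fix u :: "'a \<Rightarrow> real" assume u: "u \<in> test_funs" and B: "V_norm V u \<le> B"
    note K0(2)[OF u]
    also have "ennreal K0 * (epow (ennreal ((V_norm V u)\<^sup>2)) (\<alpha> + p / 2 * d) * epow (ennreal (\<integral>x. (u x)\<^sup>2 \<partial>lborel)) b)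
      \<le> ennreal K0 * (epow (ennreal (B\<^sup>2)) (\<alpha> + p / 2 * d) * epow (ennreal (\<integral>x. (u x)\<^sup>2 \<partial>lborel)) b)"
      using B b e by (intro mult_mono epow_mono ennreal_leI power_mono) auto
    also have "\<dots> = ennreal K * ennreal ((\<integral>x. (u x)\<^sup>2 \<partial>lborel) powr b)"
      unfolding K(2)[symmetric] using bd(1) by (simp add: epow_ennreal ac_simps)
    finally show "(\<integral>\<^sup>+x. ennreal (W x * \<bar>u x\<bar> powr \<tau>) \<partial>lborel) \<le> ennreal (K * (\<integral>x. (u x)\<^sup>2 \<partial>lborel) powr b)"
      using K(1) by (simp add: ennreal_mult)
  qed
qed

section \<open>Passage from test functions to H^1_V\<close>

lemma H1V_approx_AE_subseq:
  assumes \<phi>: "H1V_approx V \<phi> u"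
  obtains r :: "nat \<Rightarrow> nat" where "strict_mono r" "AE x in lborel. (\<lambda>n. \<phi> (r n) x) \<longlonglongrightarrow> u x"
proof -
  have "\<exists>r::nat\<Rightarrow>nat. strict_mono r \<and> (AE x in lborel. (\<lambda>n. V x * (\<phi> (r n) x - u x)\<^sup>2) \<longlonglongrightarrow> 0)"
    using \<phi> by (intro tendsto_L1_AE_subseq) (auto simp: H1V_approx_def)
  then obtain r :: "nat \<Rightarrow> nat" where r: "strict_mono r" "AE x in lborel. (\<lambda>n. V x * (\<phi> (r n) x - u x)\<^sup>2) \<longlonglongrightarrow> 0"
    by auto
  from r(2) have "AE x in lborel. (\<lambda>n. \<phi> (r n) x) \<longlonglongrightarrow> u x"
  proof eventually_elim
    case (elim x)
    \<comment> \<open>V(x) is positive at every point and can be divided out.\<close>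
    from tendsto_mult[OF tendsto_const[of "1 / V x"] elim]
    have "(\<lambda>n. (\<phi> (r n) x - u x)\<^sup>2) \<longlonglongrightarrow> 0"
      using V_pos[of x] by (simp add: less_imp_neq[symmetric])
    then have "(\<lambda>n. \<phi> (r n) x - u x) \<longlonglongrightarrow> 0" by simp
    then show ?case by (simp add: LIM_zero_iff)
  qed
  with r(1) show ?thesis by (rule that)
qed

lemma H1V_approx_V_norm_convergent:
  assumes \<phi>: "H1V_approx V \<phi> u"
  shows "convergent (\<lambda>n. V_norm V (\<phi> n))"
proof (rule Cauchy_convergent, rule metric_CauchyI)
  fix e :: real assume "0 < e"
  then obtain M where M: "\<And>m n. M \<le> m \<Longrightarrow> M \<le> n \<Longrightarrow> V_norm V (\<lambda>x. \<phi> m x - \<phi> n x) < e"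
    using \<phi> unfolding H1V_approx_def by meson
  have \<phi>t: "\<phi> n \<in> test_funs" for n using \<phi> by (simp add: H1V_approx_def)
  have "dist (V_norm V (\<phi> m)) (V_norm V (\<phi> n)) < e" if "M \<le> m" "M \<le> n" for m n
    using M[OF that] M[OF that(2,1)] V_norm_le_diff_add[OF \<phi>t \<phi>t, of m n] V_norm_le_diff_add[OF \<phi>t \<phi>t, of n m]
    by (simp add: dist_real_def)
  then show "\<exists>M. \<forall>m\<ge>M. \<forall>n\<ge>M. dist (V_norm V (\<phi> m)) (V_norm V (\<phi> n)) < e" by blast
qed

lemma H1V_E:
  assumes "u \<in> H1V V"
  obtains \<phi> where "u \<in> borel_measurable borel" "H1V_approx V \<phi> u" "(\<lambda>n. V_norm V (\<phi> n)) \<longlonglongrightarrow> H1V_norm V u" "0 \<le> H1V_norm V u"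
proof -
  \<comment> \<open>The same choice as in the definition of \<open>H1V_norm\<close>, so the V-norms
    of this sequence have that number as their limit.\<close>
  define \<phi> where "\<phi> = (SOME \<phi>. H1V_approx V \<phi> u)"
  have "\<exists>\<phi>. H1V_approx V \<phi> u" using assms by (simp add: H1V_def)
  then have \<phi>: "H1V_approx V \<phi> u"
    unfolding \<phi>_def by (rule someI_ex)
  have lim: "(\<lambda>n. V_norm V (\<phi> n)) \<longlonglongrightarrow> H1V_norm V u"
    using H1V_approx_V_norm_convergent[OF \<phi>] by (simp add: H1V_norm_def \<phi>_def convergent_LIMSEQ_iff)
  moreover from lim have "0 \<le> H1V_norm V u"
    by (rule LIMSEQ_le_const) auto
  ultimately show ?thesis using \<phi> assms by (intro that) (auto simp: H1V_def)
qed

lemma tendsto_weighted_powr: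
  assumes "(\<lambda>n. f n) \<longlonglongrightarrow> (l::real)" "0 < \<tau>"
  shows "(\<lambda>n. ennreal (W x * \<bar>f n\<bar> powr \<tau>)) \<longlonglongrightarrow> ennreal (W x * \<bar>l\<bar> powr \<tau>)"
  using assms by (intro tendsto_ennrealI tendsto_mult tendsto_const tendsto_powr' tendsto_rabs) auto

text \<open>Fatou's lemma along an almost everywhere convergent subsequence. For the second part it
  is applied to \<open>\<phi> (r m) - \<phi> n\<close> with n fixed and m growing: the Cauchy
  condition for the V-norm then makes the sequence approximate u in L^\<tau>_W as well.\<close>

lemma H1V_approx_bound:
  assumes K: "0 \<le> K" "\<And>u. u \<in> test_funs \<Longrightarrow>
      (\<integral>\<^sup>+x. ennreal (W x * \<bar>u x\<bar> powr \<tau>) \<partial>lborel) \<le> ennreal (K * V_norm V u powr \<tau>)"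
    and \<tau>: "0 < \<tau>" and \<phi>: "H1V_approx V \<phi> u" and [measurable]: "u \<in> borel_measurable borel"
  shows "(\<lambda>n. V_norm V (\<phi> n)) \<longlonglongrightarrow> L \<Longrightarrow> (\<integral>\<^sup>+x. ennreal (W x * \<bar>u x\<bar> powr \<tau>) \<partial>lborel) \<le> ennreal (K * L powr \<tau>)"
    and "0 < \<delta> \<Longrightarrow> \<exists>M. \<forall>n\<ge>M. (\<integral>\<^sup>+x. ennreal (W x * \<bar>u x - \<phi> n x\<bar> powr \<tau>) \<partial>lborel) \<le> ennreal (K * \<delta> powr \<tau>)"
proof -
  have \<phi>t: "\<phi> n \<in> test_funs" for n using \<phi> by (simp add: H1V_approx_def)
  have [measurable]: "\<phi> n \<in> borel_measurable borel" for n using \<phi>t[of n] by measurable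
  obtain r :: "nat \<Rightarrow> nat" where r: "strict_mono r" "AE x in lborel. (\<lambda>n. \<phi> (r n) x) \<longlonglongrightarrow> u x"
    by (rule H1V_approx_AE_subseq[OF \<phi>]) blast
  show "(\<integral>\<^sup>+x. ennreal (W x * \<bar>u x\<bar> powr \<tau>) \<partial>lborel) \<le> ennreal (K * L powr \<tau>)"
    if L: "(\<lambda>n. V_norm V (\<phi> n)) \<longlonglongrightarrow> L"
  proof (rule nn_integral_Fatou_bound)
    show "AE x in lborel. (\<lambda>n. ennreal (W x * \<bar>\<phi> (r n) x\<bar> powr \<tau>)) \<longlonglongrightarrow> ennreal (W x * \<bar>u x\<bar> powr \<tau>)"
      using r(2) by eventually_elim (rule tendsto_weighted_powr[OF _ \<tau>])
    show "\<forall>\<^sub>F n in sequentially. (\<integral>\<^sup>+x. ennreal (W x * \<bar>\<phi> (r n) x\<bar> powr \<tau>) \<partial>lborel) \<le> ennreal (K * V_norm V (\<phi> (r n)) powr \<tau>)"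
      by (intro always_eventually allI K(2) \<phi>t)
    have "(\<lambda>n. V_norm V (\<phi> (r n))) \<longlonglongrightarrow> L"
      using LIMSEQ_subseq_LIMSEQ[OF L r(1)] by (simp add: o_def)
    then show "(\<lambda>n. ennreal (K * V_norm V (\<phi> (r n)) powr \<tau>)) \<longlonglongrightarrow> ennreal (K * L powr \<tau>)"
      using \<tau> by (intro tendsto_ennrealI tendsto_mult tendsto_const tendsto_powr') auto
  qed measurable
  show "\<exists>M. \<forall>n\<ge>M. (\<integral>\<^sup>+x. ennreal (W x * \<bar>u x - \<phi> n x\<bar> powr \<tau>) \<partial>lborel) \<le> ennreal (K * \<delta> powr \<tau>)" if "0 < \<delta>"
  proof -
    obtain M where M: "\<And>m n. M \<le> m \<Longrightarrow> M \<le> n \<Longrightarrow> V_norm V (\<lambda>x. \<phi> m x - \<phi> n x) < \<delta>"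
      using \<phi> \<open>0 < \<delta>\<close> unfolding H1V_approx_def by meson
    have "(\<integral>\<^sup>+x. ennreal (W x * \<bar>u x - \<phi> n x\<bar> powr \<tau>) \<partial>lborel) \<le> ennreal (K * \<delta> powr \<tau>)" if n: "M \<le> n" for n
    proof (rule nn_integral_Fatou_bound)
      show "AE x in lborel. (\<lambda>m. ennreal (W x * \<bar>\<phi> (r m) x - \<phi> n x\<bar> powr \<tau>)) \<longlonglongrightarrow> ennreal (W x * \<bar>u x - \<phi> n x\<bar> powr \<tau>)"
        using r(2) by eventually_elim (intro tendsto_weighted_powr tendsto_diff tendsto_const \<tau>)
      show "\<forall>\<^sub>F m in sequentially. (\<integral>\<^sup>+x. ennreal (W x * \<bar>\<phi> (r m) x - \<phi> n x\<bar> powr \<tau>) \<partial>lborel) \<le> ennreal (K * \<delta> powr \<tau>)"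
        using eventually_ge_at_top[of M]
      proof eventually_elim
        case (elim m)
        then have "M \<le> r m" using seq_suble[OF r(1), of m] by linarith
        have "(\<integral>\<^sup>+x. ennreal (W x * \<bar>\<phi> (r m) x - \<phi> n x\<bar> powr \<tau>) \<partial>lborel)
            \<le> ennreal (K * V_norm V (\<lambda>x. \<phi> (r m) x - \<phi> n x) powr \<tau>)"
          by (rule K(2)[OF test_funs_diff[OF \<phi>t \<phi>t]])
        also have "\<dots> \<le> ennreal (K * \<delta> powr \<tau>)"
          using K(1) \<tau> M[OF \<open>M \<le> r m\<close> n] by (intro ennreal_leI mult_left_mono powr_mono2) auto
        finally show ?case .
      qed
    qed auto
    then show ?thesis by blast
  qed
qed

lemma LW_I:
  assumes [measurable]: "u \<in> borel_measurable borel"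
    and le: "(\<integral>\<^sup>+x. ennreal (W x * \<bar>u x\<bar> powr \<tau>) \<partial>lborel) \<le> ennreal M" and M: "0 \<le> M"
  shows "u \<in> LW W \<tau>" "(\<integral>x. W x * \<bar>u x\<bar> powr \<tau> \<partial>lborel) \<le> M"
proof -
  have int: "integrable lborel (\<lambda>x. W x * \<bar>u x\<bar> powr \<tau>)"
    using le W_nonneg by (intro integrableI_nonneg) (auto simp: le_less_trans)
  then show "u \<in> LW W \<tau>" by (simp add: LW_def)
  show "(\<integral>x. W x * \<bar>u x\<bar> powr \<tau> \<partial>lborel) \<le> M"
    using le M nn_integral_eq_integral[OF int] W_nonneg by simp
qed

theorem cont_embedded_sobolev:
  assumes S: "sobolev_exponent TYPE('a) p" and p: "2 \<le> p"
    and bd: "0 \<le> b" "0 \<le> d" "\<alpha> + b + d = 1" and \<tau>: "\<tau> = 2 * \<alpha> + 2 * b + p * d"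
  shows "cont_embedded V W \<tau>"
proof -
  have \<tau>0: "0 < \<tau>" using \<tau> bd \<alpha> p by (auto intro: add_pos_nonneg)
  obtain K where K: "0 \<le> K" "\<And>u. u \<in> test_funs \<Longrightarrow>
      (\<integral>\<^sup>+x. ennreal (W x * \<bar>u x\<bar> powr \<tau>) \<partial>lborel) \<le> ennreal (K * V_norm V u powr \<tau>)"
    by (rule test_funs_embedding[OF assms]) blast
  have "u \<in> LW W \<tau> \<and> LW_norm W \<tau> u \<le> K powr (1 / \<tau>) * H1V_norm V u" if uH: "u \<in> H1V V" for u
  proof -
    obtain \<phi> where u: "u \<in> borel_measurable borel" "H1V_approx V \<phi> u" "(\<lambda>n. V_norm V (\<phi> n)) \<longlonglongrightarrow> H1V_norm V u"
      "0 \<le> H1V_norm V u"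
      by (rule H1V_E[OF uH])
    have "(\<integral>\<^sup>+x. ennreal (W x * \<bar>u x\<bar> powr \<tau>) \<partial>lborel) \<le> ennreal (K * H1V_norm V u powr \<tau>)"
      by (rule H1V_approx_bound(1)[OF K \<tau>0 u(2,1,3)])
    note LW = LW_I[OF u(1) this] 
    have "LW_norm W \<tau> u \<le> (K * H1V_norm V u powr \<tau>) powr (1 / \<tau>)"
      unfolding LW_norm_def using LW(2) K(1) \<tau>0 W_nonneg by (intro powr_mono2) (auto intro!: integral_nonneg_AE)
    also have "\<dots> = K powr (1 / \<tau>) * H1V_norm V u"
      using \<tau>0 u(4) by (simp add: powr_mult powr_powr)
    finally show ?thesis using LW(1) K(1) by simp
  qed
  then show ?thesis unfolding cont_embedded_def by blast
qed

text \<open>Each \<open>u k\<close> is replaced by a test function within 1/(k + 1) of it in the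
  weighted integral. Rellich's theorem makes a subsequence of these Cauchy in L^2, a further one
  converges almost everywhere to v, and interpolation with Fatou's lemma upgrades this to
  convergence in L^\<tau>_W.\<close>

theorem compact_embedded_sobolev:
  assumes S: "sobolev_exponent TYPE('a) p" and p: "2 \<le> p"
    and bd: "0 < b" "0 \<le> d" "\<alpha> + b + d = 1" and \<tau>: "\<tau> = 2 * \<alpha> + 2 * b + p * d"
    and lim: "filterlim V at_top at_infinity"
  shows "compact_embedded V W \<tau>"
proof -
  have b: "0 \<le> b" using bd by simp
  have \<tau>0: "0 < \<tau>" using \<tau> bd \<alpha> p by (auto intro: add_pos_nonneg)
  define I where "I f = (\<integral>\<^sup>+x. ennreal (W x * \<bar>f x\<bar> powr \<tau>) \<partial>lborel)" for f
  obtain K where K: "0 \<le> K" "\<And>u. u \<in> test_funs \<Longrightarrow> I u \<le> ennreal (K * V_norm V u powr \<tau>)"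
    unfolding I_def by (rule test_funs_embedding[OF S p b bd(2,3) \<tau>]) blast
  have I_diff: "I (\<lambda>x. f x - g x) \<le> ennreal (2 powr \<tau>) * (I f + I g)"
    if [measurable]: "f \<in> borel_measurable borel" "g \<in> borel_measurable borel" for f g
  proof -
    have "I (\<lambda>x. f x - g x) \<le> (\<integral>\<^sup>+x. ennreal (2 powr \<tau>) * (ennreal (W x * \<bar>f x\<bar> powr \<tau>) + ennreal (W x * \<bar>g x\<bar> powr \<tau>)) \<partial>lborel)"
      unfolding I_def
    proof (intro nn_integral_mono)
      fix x
      have "W x * \<bar>f x - g x\<bar> powr \<tau> \<le> W x * (2 powr \<tau> * (\<bar>f x\<bar> powr \<tau> + \<bar>g x\<bar> powr \<tau>))"
        using W_nonneg \<tau>0 by (intro mult_left_mono abs_diff_powr_le) auto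
      also have "\<dots> = 2 powr \<tau> * (W x * \<bar>f x\<bar> powr \<tau> + W x * \<bar>g x\<bar> powr \<tau>)"
        by (simp add: algebra_simps)
      finally have "ennreal (W x * \<bar>f x - g x\<bar> powr \<tau>) \<le> ennreal (2 powr \<tau> * (W x * \<bar>f x\<bar> powr \<tau> + W x * \<bar>g x\<bar> powr \<tau>))"
        by (rule ennreal_leI)
      then show "ennreal (W x * \<bar>f x - g x\<bar> powr \<tau>) \<le> ennreal (2 powr \<tau>) * (ennreal (W x * \<bar>f x\<bar> powr \<tau>) + ennreal (W x * \<bar>g x\<bar> powr \<tau>))"
        using W_nonneg[of x] by (simp add: ennreal_mult)
    qed
    also have "\<dots> = ennreal (2 powr \<tau>) * (I f + I g)"
      unfolding I_def by (simp add: nn_integral_cmult nn_integral_add)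
    finally show ?thesis .
  qed
  have "\<exists>r v. strict_mono r \<and> v \<in> LW W \<tau> \<and> (\<lambda>k. LW_norm W \<tau> (\<lambda>x. u (r k) x - v x)) \<longlonglongrightarrow> 0"
    if u: "\<And>k. u k \<in> H1V V" and B: "\<And>k. H1V_norm V (u k) \<le> B" for u :: "nat \<Rightarrow> 'a \<Rightarrow> real" and B
  proof -
    have u_meas [measurable]: "u k \<in> borel_measurable borel" for k using u[of k] by (simp add: H1V_def)
    \<comment> \<open>The V-norms of an approximating sequence tend to a number at most B, hence are
      eventually below B + 1.\<close>
    have "\<exists>\<psi>. \<psi> \<in> test_funs \<and> V_norm V \<psi> \<le> B + 1 \<and> I (\<lambda>x. u k x - \<psi> x) \<le> ennreal (1 / real (Suc k))" for k
    proof -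
      obtain \<phi> where \<phi>: "H1V_approx V \<phi> (u k)" "(\<lambda>n. V_norm V (\<phi> n)) \<longlonglongrightarrow> H1V_norm V (u k)"
        by (rule H1V_E[OF u[of k]])
      \<comment> \<open>Chosen so that K \<delta>^\<tau> \<le> 1/(k + 1).\<close>
      define \<delta> where "\<delta> = (1 / real (Suc k) / (K + 1)) powr (1 / \<tau>)"
      have "0 < \<delta>" using K(1) by (simp add: \<delta>_def)
      have "\<delta> powr \<tau> = 1 / real (Suc k) / (K + 1)"
        using K(1) \<tau>0 by (simp add: \<delta>_def powr_powr)
      then have \<delta>: "K * \<delta> powr \<tau> \<le> 1 / real (Suc k)"
        using mult_divide_add_one_le[OF K(1), of "1 / real (Suc k)"] by simp
      obtain M where M: "\<And>n. M \<le> n \<Longrightarrow> I (\<lambda>x. u k x - \<phi> n x) \<le> ennreal (K * \<delta> powr \<tau>)"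
        using H1V_approx_bound(2)[OF K(1) K(2)[unfolded I_def] \<tau>0 \<phi>(1) u_meas \<open>0 < \<delta>\<close>] unfolding I_def by blast
      have "\<forall>\<^sub>F n in sequentially. V_norm V (\<phi> n) < B + 1"
        using B[of k] by (intro order_tendstoD(2)[OF \<phi>(2)]) auto
      then have "\<forall>\<^sub>F n in sequentially. M \<le> n \<and> V_norm V (\<phi> n) < B + 1"
        using eventually_ge_at_top[of M] by eventually_elim simp
      then obtain n where n: "M \<le> n" "V_norm V (\<phi> n) < B + 1"
        using eventually_happens by fastforce
      have "I (\<lambda>x. u k x - \<phi> n x) \<le> ennreal (1 / real (Suc k))"
        using M[OF n(1)] ennreal_leI[OF \<delta>] by (rule order_trans)
      moreover have "\<phi> n \<in> test_funs" using \<phi>(1) by (simp add: H1V_approx_def)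
      ultimately show ?thesis using n(2) by (intro exI[of _ "\<phi> n"]) auto
    qed
    then obtain \<psi> where \<psi>: "\<And>k. \<psi> k \<in> test_funs" "\<And>k. V_norm V (\<psi> k) \<le> B + 1"
      "\<And>k. I (\<lambda>x. u k x - \<psi> k x) \<le> ennreal (1 / real (Suc k))"
      by metis
    have \<psi>_meas [measurable]: "\<psi> k \<in> borel_measurable borel" for k using \<psi>(1)[of k] by measurable
    obtain r :: "nat \<Rightarrow> nat" where r: "strict_mono r"
      "\<And>e. 0 < e \<Longrightarrow> \<exists>M. \<forall>m\<ge>M. \<forall>n\<ge>M. (\<integral>x. (\<psi> (r m) x - \<psi> (r n) x)\<^sup>2 \<partial>lborel) < e"
      by (rule Rellich_test_funs[where \<psi> = \<psi>, OF \<psi>(1,2) lim]) blast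
    have sq_int: "integrable lborel (\<lambda>x. (\<psi> m x - \<psi> n x)\<^sup>2)" for m n
      using test_funs_integrable_sq[OF test_funs_diff[OF \<psi>(1) \<psi>(1)], of "\<lambda>_. 1"] by simp
    obtain r' :: "nat \<Rightarrow> nat" where r': "strict_mono r'" "AE x in lborel. convergent (\<lambda>n. \<psi> (r (r' n)) x)"
      by (rule L2_Cauchy_AE_subseq[of "\<lambda>n. \<psi> (r n)" lborel, OF _ sq_int r(2)]) auto
    define \<rho> where "\<rho> n = r (r' n)" for n
    have \<rho>: "strict_mono \<rho>"
      unfolding \<rho>_def using strict_mono_o[OF r(1) r'(1)] by (simp add: o_def)
    \<comment> \<open>Off the set of convergence \<open>lim\<close> is an unspecified value; that
      set of points is null, and v is measurable all the same.\<close>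
    define v where "v x = lim (\<lambda>n. \<psi> (\<rho> n) x)" for x
    have v_meas [measurable]: "v \<in> borel_measurable borel"
      unfolding v_def by measurable
    have v_lim: "AE x in lborel. (\<lambda>n. \<psi> (\<rho> n) x) \<longlonglongrightarrow> v x"
      using r'(2) by (simp add: v_def \<rho>_def convergent_LIMSEQ_iff)
    obtain K' where K': "0 \<le> K'" "\<And>w. w \<in> test_funs \<Longrightarrow> V_norm V w \<le> 2 * (B + 1) \<Longrightarrow>
        I w \<le> ennreal (K' * (\<integral>x. (w x)\<^sup>2 \<partial>lborel) powr b)"
      unfolding I_def by (rule test_funs_interpolation[OF S p bd \<tau>, where B = "2 * (B + 1)"]) blast
    have conv: "\<exists>M. \<forall>n\<ge>M. I (\<lambda>x. \<psi> (\<rho> n) x - v x) \<le> ennreal e" if e: "0 < e" for e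
    proof -
      \<comment> \<open>The L^2 tolerance for which the interpolation bound K' \<eta>^b does not
        exceed e.\<close>
      define \<eta> where "\<eta> = (e / (K' + 1)) powr (1 / b)"
      have "0 < \<eta>" using K'(1) e by (simp add: \<eta>_def)
      have "\<eta> powr b = e / (K' + 1)"
        using K'(1) e bd(1) by (simp add: \<eta>_def powr_powr)
      then have \<eta>: "K' * \<eta> powr b \<le> e"
        using mult_divide_add_one_le[OF K'(1), of e] e by simp
      obtain M where M: "\<And>m n. M \<le> m \<Longrightarrow> M \<le> n \<Longrightarrow> (\<integral>x. (\<psi> (r m) x - \<psi> (r n) x)\<^sup>2 \<partial>lborel) < \<eta>"
        using r(2)[OF \<open>0 < \<eta>\<close>] by blast
      have "I (\<lambda>x. \<psi> (\<rho> n) x - v x) \<le> ennreal e" if n: "M \<le> n" for n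
        unfolding I_def
      proof (rule nn_integral_Fatou_bound)
        show "AE x in lborel. (\<lambda>m. ennreal (W x * \<bar>\<psi> (\<rho> n) x - \<psi> (\<rho> m) x\<bar> powr \<tau>)) \<longlonglongrightarrow> ennreal (W x * \<bar>\<psi> (\<rho> n) x - v x\<bar> powr \<tau>)"
          using v_lim by eventually_elim (intro tendsto_weighted_powr tendsto_diff tendsto_const \<tau>0)
        show "\<forall>\<^sub>F m in sequentially. (\<integral>\<^sup>+x. ennreal (W x * \<bar>\<psi> (\<rho> n) x - \<psi> (\<rho> m) x\<bar> powr \<tau>) \<partial>lborel) \<le> ennreal e"
          using eventually_ge_at_top[of M]
        proof eventually_elim
          case (elim m)
          let ?w = "\<lambda>x. \<psi> (\<rho> n) x - \<psi> (\<rho> m) x"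
          have "V_norm V ?w \<le> 2 * (B + 1)"
            by (rule order_trans[OF V_norm_diff_le[OF \<psi>(1) \<psi>(1)]])
               (use add_mono[OF \<psi>(2)[of "\<rho> n"] \<psi>(2)[of "\<rho> m"]] in simp)
          then have "I ?w \<le> ennreal (K' * (\<integral>x. (?w x)\<^sup>2 \<partial>lborel) powr b)"
            by (intro K'(2) test_funs_diff \<psi>(1))
          also have "\<dots> \<le> ennreal (K' * \<eta> powr b)"
            using M[of "r' n" "r' m"] seq_suble[OF r'(1), of n] seq_suble[OF r'(1), of m] n elim bd(1) K'(1)
            unfolding \<rho>_def by (intro ennreal_leI mult_left_mono powr_mono2) auto
          also have "\<dots> \<le> ennreal e" using \<eta> by (rule ennreal_leI)
          finally show ?case by (simp add: I_def)
        qed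
      qed auto
      then show ?thesis by blast
    qed
    have I_lim: "\<exists>M. \<forall>n\<ge>M. I (\<lambda>x. u (\<rho> n) x - v x) \<le> ennreal e" if e: "0 < e" for e
    proof -
      \<comment> \<open>Halves e after dividing by the constant 2^\<tau> of the quasi-triangle
        inequality \<open>I_diff\<close>.\<close>
      define e' where "e' = e / (2 powr \<tau>) / 2"
      have e': "0 < e'" "2 powr \<tau> * (e' + e') = e" using e by (auto simp: e'_def)
      obtain M1 where M1: "\<And>n. M1 \<le> n \<Longrightarrow> I (\<lambda>x. \<psi> (\<rho> n) x - v x) \<le> ennreal e'"
        using conv[OF e'(1)] by blast
      obtain M2 where M2: "1 / real (Suc M2) < e'"
        using e'(1) by (metis inverse_eq_divide reals_Archimedean)
      have "I (\<lambda>x. u (\<rho> n) x - v x) \<le> ennreal e" if n: "max M1 M2 \<le> n" for n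
      proof -
        have "M2 \<le> \<rho> n" using n seq_suble[OF \<rho>, of n] by linarith
        then have "1 / real (Suc (\<rho> n)) \<le> 1 / real (Suc M2)" by (intro divide_left_mono) auto
        then have "1 / real (Suc (\<rho> n)) \<le> e'" using M2 by linarith
        then have "I (\<lambda>x. u (\<rho> n) x - \<psi> (\<rho> n) x) \<le> ennreal e'"
          using \<psi>(3)[of "\<rho> n"] by (meson ennreal_leI order_trans)
        moreover have "I (\<lambda>x. v x - \<psi> (\<rho> n) x) \<le> ennreal e'"
          using M1[of n] n by (simp add: I_def abs_minus_commute)
        \<comment> \<open>\<open>I_diff\<close> is stated for differences, so u - v is written as (u
          - \<psi>) - (v - \<psi>).\<close>
        moreover have "I (\<lambda>x. u (\<rho> n) x - v x) \<le> ennreal (2 powr \<tau>) * (I (\<lambda>x. u (\<rho> n) x - \<psi> (\<rho> n) x) + I (\<lambda>x. v x - \<psi> (\<rho> n) x))"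
          using I_diff[of "\<lambda>x. u (\<rho> n) x - \<psi> (\<rho> n) x" "\<lambda>x. v x - \<psi> (\<rho> n) x"] by simp
        ultimately have "I (\<lambda>x. u (\<rho> n) x - v x) \<le> ennreal (2 powr \<tau>) * (ennreal e' + ennreal e')"
          by (meson add_mono mult_left_mono order_trans zero_le)
        also have "\<dots> = ennreal e"
          unfolding e'(2)[symmetric] using e'(1) by (simp only: ennreal_mult ennreal_plus powr_ge_zero less_imp_le add_nonneg_nonneg)
        finally show ?thesis .
      qed
      then show ?thesis by blast
    qed
    have "v \<in> LW W \<tau>"
    proof -
      obtain M where M: "\<And>n. M \<le> n \<Longrightarrow> I (\<lambda>x. \<psi> (\<rho> n) x - v x) \<le> ennreal 1"
        using conv[of 1] by auto
      \<comment> \<open>v = \<psi> - (\<psi> - v) for one late term \<psi>, whose weighted integral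
        is finite by the embedding for test functions.\<close>
      have "I v \<le> ennreal (2 powr \<tau>) * (I (\<psi> (\<rho> M)) + I (\<lambda>x. \<psi> (\<rho> M) x - v x))"
        using I_diff[of "\<psi> (\<rho> M)" "\<lambda>x. \<psi> (\<rho> M) x - v x"] by simp
      also have "\<dots> \<le> ennreal (2 powr \<tau>) * (ennreal (K * V_norm V (\<psi> (\<rho> M)) powr \<tau>) + ennreal 1)"
        using K(2)[OF \<psi>(1)] M by (intro mult_left_mono add_mono) auto
      also have "\<dots> = ennreal (2 powr \<tau> * (K * V_norm V (\<psi> (\<rho> M)) powr \<tau> + 1))"
        using K(1) by (simp add: ennreal_mult)
      finally show ?thesis
        unfolding I_def by (rule LW_I(1)[OF v_meas]) (use K(1) in simp)
    qed
    moreover have "(\<lambda>k. LW_norm W \<tau> (\<lambda>x. u (\<rho> k) x - v x)) \<longlonglongrightarrow> 0"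
      unfolding LW_norm_def
    proof (rule tendsto_zero_powrI[where b = "1 / \<tau>"])
      show "(\<lambda>k. \<integral>x. W x * \<bar>u (\<rho> k) x - v x\<bar> powr \<tau> \<partial>lborel) \<longlonglongrightarrow> 0"
      proof (rule LIMSEQ_I)
        fix e :: real assume "0 < e"
        then obtain M where M: "\<And>n. M \<le> n \<Longrightarrow> I (\<lambda>x. u (\<rho> n) x - v x) \<le> ennreal (e / 2)"
          using I_lim[of "e / 2"] by auto
        have "norm ((\<integral>x. W x * \<bar>u (\<rho> n) x - v x\<bar> powr \<tau> \<partial>lborel) - 0) < e" if "M \<le> n" for n
        proof -
          have "(\<integral>x. W x * \<bar>u (\<rho> n) x - v x\<bar> powr \<tau> \<partial>lborel) \<le> e / 2"
            using M[OF that] \<open>0 < e\<close> unfolding I_def by (intro LW_I(2)) auto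
          moreover have "0 \<le> (\<integral>x. W x * \<bar>u (\<rho> n) x - v x\<bar> powr \<tau> \<partial>lborel)"
            using W_nonneg by (intro integral_nonneg_AE) auto
          ultimately show ?thesis using \<open>0 < e\<close> by simp
        qed
        then show "\<exists>M. \<forall>n\<ge>M. norm ((\<integral>x. W x * \<bar>u (\<rho> n) x - v x\<bar> powr \<tau> \<partial>lborel) - 0) < e" by blast
      qed
      show "\<forall>\<^sub>F k in sequentially. 0 \<le> (\<integral>x. W x * \<bar>u (\<rho> k) x - v x\<bar> powr \<tau> \<partial>lborel)"
        using W_nonneg by (intro always_eventually allI integral_nonneg_AE) auto
    qed (use \<tau>0 in auto)
    ultimately show ?thesis using \<rho> by blast
  qed
  then show ?thesis
    unfolding compact_embedded_def
    using cont_embedded_sobolev[OF S p b bd(2,3) \<tau>] by blast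
qed

end

section \<open>Choice of the interpolation exponents\<close>

theorem theorem2p2:
  fixes V W :: "'a::euclidean_space \<Rightarrow> real" and \<alpha> c C :: real
  assumes "continuous_on UNIV V" and "continuous_on UNIV W"
    and "bdd_below (range V)" and "(INF x. V x) > 0"
    and "bdd_below (range W)" and "(INF x. W x) > 0"
    and "0 < \<alpha>" and "\<alpha> < 1" and "0 < c" and "0 < C"
    and "\<forall>x. 0 < c \<and> c \<le> W x \<and> W x \<le> C * (V x) powr \<alpha>"
    and "filterlim V at_top at_infinity"
  shows "(DIM('a) \<le> 2 \<longrightarrow> (\<forall>\<tau>::real. 2 \<le> \<tau> \<longrightarrow> compact_embedded V W \<tau>)) \<and>
         (DIM('a) \<ge> 3 \<longrightarrow>
            (\<forall>\<tau>::real. 2 \<le> \<tau> \<and> \<tau> < (2 * real DIM('a) - 4 * \<alpha>) / (real DIM('a) - 2)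
                 \<longrightarrow> compact_embedded V W \<tau>) \<and>
            cont_embedded V W ((2 * real DIM('a) - 4 * \<alpha>) / (real DIM('a) - 2)))"
proof -
  interpret weighted_potential V "INF x. V x" W \<alpha> C
  proof
    show "(INF x. V x) \<le> V x" for x
      using assms(3) by (intro cINF_lower) auto
    show "0 \<le> W x" for x
      using assms(11) by (meson less_imp_le order_trans)
  qed (use assms in auto)
  have compact: "compact_embedded V W \<tau>"
    if S: "sobolev_exponent TYPE('a) p" and \<tau>: "2 \<le> \<tau>" "\<tau> < 2 * \<alpha> + p * (1 - \<alpha>)" for p \<tau>
  proof -
    \<comment> \<open>From 2 = 2 \<alpha> + 2 (1 - \<alpha>) \<le> \<tau> < 2 \<alpha> + p (1 -
      \<alpha>) it follows that p > 2, so the next definition may divide by p - 2.\<close>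
    have "2 * (1 - \<alpha>) < p * (1 - \<alpha>)" using \<tau> by (simp add: algebra_simps)
    then have p: "2 < p" by (rule mult_right_less_imp_less) (use assms(8) in simp)
    \<comment> \<open>The solution of \<tau> = 2 \<alpha> + 2b + p d with b = 1 - \<alpha> - d. The
      strict upper bound on \<tau> is equivalent to b > 0.\<close>
    define d where "d = (\<tau> - 2) / (p - 2)"
    have d: "0 \<le> d" "d * (p - 2) = \<tau> - 2" using p \<tau>(1) by (auto simp: d_def)
    have "d * (p - 2) < (1 - \<alpha>) * (p - 2)" unfolding d(2) using \<tau>(2) by (simp add: algebra_simps)
    then have "d < 1 - \<alpha>" using p by simp
    then show ?thesis
      using d p by (intro compact_embedded_sobolev[OF S, of "1 - \<alpha> - d" d] assms(12)) (auto simp: algebra_simps)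
  qed
  show ?thesis
  proof (intro conjI impI allI; (elim conjE)?)
    fix \<tau> :: real assume N: "DIM('a) \<le> 2" and \<tau>: "2 \<le> \<tau>"
    \<comment> \<open>In low dimension p = 2m is available for every m > 0, so the upper bound 2
      \<alpha> + 2m (1 - \<alpha>) can be pushed beyond any given \<tau>.\<close>
    obtain m :: nat where m: "\<tau> / (1 - \<alpha>) < real m" using reals_Archimedean2 by blast
    have "0 < \<tau> / (1 - \<alpha>)" using assms(8) \<tau> by simp
    then have "0 < m" using m by (metis of_nat_0_less_iff order_less_trans)
    have "\<tau> < real m * (1 - \<alpha>)" using m assms(8) by (simp add: field_simps)
    also have "\<dots> \<le> 2 * real m * (1 - \<alpha>)" using assms(8) by simp
    finally have "\<tau> < 2 * \<alpha> + 2 * real m * (1 - \<alpha>)" using assms(7) by linarith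
    then show "compact_embedded V W \<tau>"
      by (rule compact[OF sobolev_exponent_low_dim[OF N \<open>0 < m\<close>] \<tau>])
  next
    assume N: "3 \<le> DIM('a)"
    define p where "p = 2 * real DIM('a) / (real DIM('a) - 2)"
    have p: "sobolev_exponent TYPE('a) p" "2 \<le> p"
      using sobolev_exponent_critical[OF N] N by (auto simp: p_def field_simps)
    have crit: "(2 * real DIM('a) - 4 * \<alpha>) / (real DIM('a) - 2) = 2 * \<alpha> + p * (1 - \<alpha>)"
      using N by (simp add: p_def field_simps)
    show "compact_embedded V W \<tau>"
      if "2 \<le> \<tau>" "\<tau> < (2 * real DIM('a) - 4 * \<alpha>) / (real DIM('a) - 2)" for \<tau>
      using that unfolding crit by (intro compact[OF p(1)])
    show "cont_embedded V W ((2 * real DIM('a) - 4 * \<alpha>) / (real DIM('a) - 2))"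
      \<comment> \<open>The endpoint b = 0, d = 1 - \<alpha>: no power of the L^2 norm is left
        over.\<close>
      unfolding crit using assms(8) by (intro cont_embedded_sobolev[OF p, of 0 "1 - \<alpha>"]) auto
  qed
qed

end
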